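(* Let $n$ and $p$ be positive integers with $\gcd(n,p)=1$. For generic $x,y\in\mathbb{C}^*$, \[ f_{n,n+p,n}(x,y,q)=g_{n,n+p,n}(x,y,q,-1,-1)+\frac{1}{\overline{J}_{0,np(2n+p)}}\,\theta_{n,p}(x,y,q), \] where \begin{align*} \theta_{n,p}(x,y,q):=\sum_{r^*=0}^{p-1}\sum_{s^*=0}^{p-1}&q^{n\binom{r-(n-1)/2}{2}+(n+p)\big(r-(n-1)/2\big)\big(s+(n+1)/2\big)+n\binom{s+(n+1)/2}{2}}(-x)^{r-(n-1)/2}(-y)^{s+(n+1)/2}\\ &\cdot\frac{J_{p^2(2n+p)}^3\,j(-q^{np(s-r)}x^n/y^n;q^{np^2})\,j(q^{p(2n+p)(r+s)+p(n+p)}x^py^p;q^{p^2(2n+p)})}{j\big(q^{p(2n+p)r+p(n+p)/2}(-y)^{n+p}/(-x)^n;q^{p^2(2n+p)}\big)\,j\big(q^{p(2n+p)s+p(n+p)/2}(-x)^{n+p}/(-y)^n;q^{p^2(2n+p)}\big)}, \end{align*} with $r:=r^*+\{(n-1)/2\}$ and $s:=s^*+\{(n-1)/2\}$, where $0\le\{\alpha\}<1$ denotes the fractional part of $\alpha$.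
   Context: Let $q\in\mathbb{C}$ with $0<|q|<1$. Notation: $(x)_\infty=(x;q)_\infty=\prod_{i\ge0}(1-q^ix)$; $j(x;q):=(x)_\infty(q/x)_\infty(q)_\infty=\sum_{n\in\mathbb{Z}}(-1)^nq^{\binom n2}x^n$; for integers $a$ and $m>0$, $J_{a,m}:=j(q^a;q^m)$, $\overline{J}_{a,m}:=j(-q^a;q^m)$, $J_m:=J_{m,3m}=\prod_{i\ge1}(1-q^{mi})$. The Appell–Lerch sum is $m(x,q,z):=\frac{1}{j(z;q)}\sum_{r\in\mathbb{Z}}\frac{(-1)^rq^{\binom r2}z^r}{1-q^{r-1}xz}$ for $x,z\in\mathbb{C}^*$ with neither $z$ nor $xz$ an integral power of $q$. For $x,y\in\mathbb{C}^*$ and positive integers $a,b,c$, with $\mathrm{sg}(r)=1$ for $r\ge0$ and $\mathrm{sg}(r)=-1$ for $r<0$, $f_{a,b,c}(x,y,q):=\sum_{\mathrm{sg}(r)=\mathrm{sg}(s)}\mathrm{sg}(r)(-1)^{r+s}x^ry^sq^{a\binom r2+brs+c\binom s2}$, and \begin{align*} g_{a,b,c}(x,y,q,z_1,z_0):=&\sum_{t=0}^{a-1}(-y)^tq^{c\binom t2}j(q^{bt}x;q^a)\,m\Big(-q^{a\binom{b+1}{2}-c\binom{a+1}{2}-t(b^2-ac)}\frac{(-y)^a}{(-x)^b},q^{a(b^2-ac)},z_0\Big)\\ &+\sum_{t=0}^{c-1}(-x)^tq^{a\binom t2}j(q^{bt}y;q^c)\,m\Big(-q^{c\binom{b+1}{2}-a\binom{c+1}{2}-t(b^2-ac)}\frac{(-x)^c}{(-y)^b},q^{c(b^2-ac)},z_1\Big).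 \end{align*} "Generic" means $x,y,q$ are such that no Appell–Lerch sum or theta quotient in the identity has a pole. *)

theory Defs
  imports "HOL-Analysis.Analysis"
begin

definition qpoch_inf :: "complex \<Rightarrow> complex \<Rightarrow> complex" where
  "qpoch_inf x q = (\<Prod>i. 1 - q ^ i * x)"

definition jtheta :: "complex \<Rightarrow> complex \<Rightarrow> complex" where
  "jtheta x q = qpoch_inf x q * qpoch_inf (q / x) q * qpoch_inf q q"

definition J2 :: "int \<Rightarrow> int \<Rightarrow> complex \<Rightarrow> complex" where
  "J2 a m q = jtheta (q powi a) (q powi m)"

definition Jbar :: "int \<Rightarrow> int \<Rightarrow> complex \<Rightarrow> complex" where
  "Jbar a m q = jtheta (- (q powi a)) (q powi m)"

definition J1 :: "int \<Rightarrow> complex \<Rightarrow> complex" where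
  "J1 m q = J2 m (3 * m) q"

definition binom2 :: "int \<Rightarrow> int" where
  "binom2 r = r * (r - 1) div 2"

definition appell_lerch :: "complex \<Rightarrow> complex \<Rightarrow> complex \<Rightarrow> complex" where
  "appell_lerch x q z = 1 / jtheta z q *
     (\<Sum>\<^sub>\<infinity>r::int. (-1) powi r * q powi (binom2 r) * z powi r / (1 - q powi (r - 1) * x * z))"

definition appell_lerch_defined :: "complex \<Rightarrow> complex \<Rightarrow> complex \<Rightarrow> bool" where
  "appell_lerch_defined x q z \<longleftrightarrow>
     x \<noteq> 0 \<and> z \<noteq> 0 \<and> (\<forall>k::int. z \<noteq> q powi k) \<and> (\<forall>k::int. x * z \<noteq> q powi k)"

(* Differs from the library's sgn at 0. *)
definition sg :: "int \<Rightarrow> int" where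
  "sg r = (if r \<ge> 0 then 1 else -1)"

definition hecke_f :: "int \<Rightarrow> int \<Rightarrow> int \<Rightarrow> complex \<Rightarrow> complex \<Rightarrow> complex \<Rightarrow> complex" where
  "hecke_f a b c x y q =
     (\<Sum>\<^sub>\<infinity>(r, s)\<in>{(r, s). sg r = sg s}.
        of_int (sg r) * (-1) powi (r + s) * x powi r * y powi s *
        q powi (a * binom2 r + b * r * s + c * binom2 s))"

(* First argument of the t-th Appell-Lerch sum in the first half of g_{a,b,c}(x,y,q,z1,z0);
   the second half is obtained by exchanging a with c and x with y. *)
definition g_arg :: "int \<Rightarrow> int \<Rightarrow> int \<Rightarrow> complex \<Rightarrow> complex \<Rightarrow> complex \<Rightarrow> int \<Rightarrow> complex" where
  "g_arg a b c x y q t =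
     - (q powi (a * binom2 (b + 1) - c * binom2 (a + 1) - t * (b\<^sup>2 - a * c)))
       * ((- y) powi a / (- x) powi b)"

definition hecke_g ::
  "int \<Rightarrow> int \<Rightarrow> int \<Rightarrow> complex \<Rightarrow> complex \<Rightarrow> complex \<Rightarrow> complex \<Rightarrow> complex \<Rightarrow> complex" where
  "hecke_g a b c x y q z1 z0 =
     (\<Sum>t=0..a-1. (- y) powi t * q powi (c * binom2 t) * jtheta (q powi (b * t) * x) (q powi a) *
        appell_lerch (g_arg a b c x y q t) (q powi (a * (b\<^sup>2 - a * c))) z0) +
     (\<Sum>t=0..c-1. (- x) powi t * q powi (a * binom2 t) * jtheta (q powi (b * t) * y) (q powi c) *
        appell_lerch (g_arg c b a y x q t) (q powi (c * (b\<^sup>2 - a * c))) z1)"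

definition half_shift :: "int \<Rightarrow> int \<Rightarrow> real" where
  "half_shift n k = of_int k + frac (of_int (n - 1) / 2)"

(* Theta function in the denominator of the summands of theta_{n,p}(x,y,q); r lies in (1/2)Z.
   The exponents under the floor brackets, here and in theta_np, are integers when n and p are
   coprime (lemmas below), so the floor only converts their type. *)
definition theta_den :: "int \<Rightarrow> int \<Rightarrow> complex \<Rightarrow> complex \<Rightarrow> complex \<Rightarrow> real \<Rightarrow> complex" where
  "theta_den n p x y q r =
     jtheta (q powi \<lfloor>of_int (p * (2 * n + p)) * r + of_int (p * (n + p)) / 2\<rfloor>
               * ((- y) powi (n + p) / (- x) powi n))
            (q powi (p\<^sup>2 * (2 * n + p)))"

definition theta_np :: "int \<Rightarrow> int \<Rightarrow> complex \<Rightarrow> complex \<Rightarrow> complex \<Rightarrow> complex" where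
  "theta_np n p x y q =
     (\<Sum>r'=0..p-1. \<Sum>s'=0..p-1.
        let r = half_shift n r'; s = half_shift n s';
            u = r - of_int (n - 1) / 2; v = s + of_int (n + 1) / 2
        in q powi \<lfloor>of_int n * (u gchoose 2) + of_int (n + p) * u * v + of_int n * (v gchoose 2)\<rfloor>
           * (- x) powi \<lfloor>u\<rfloor> * (- y) powi \<lfloor>v\<rfloor>
           * (J1 (p\<^sup>2 * (2 * n + p)) q ^ 3
              * jtheta (- (q powi \<lfloor>of_int (n * p) * (s - r)\<rfloor>) * (x powi n / y powi n)) (q powi (n * p\<^sup>2))
              * jtheta (q powi \<lfloor>of_int (p * (2 * n + p)) * (r + s) + of_int (p * (n + p))\<rfloor>
                          * x powi p * y powi p)
                       (q powi (p\<^sup>2 * (2 * n + p))))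
           / (theta_den n p x y q r * theta_den n p y x q s))"

definition generic_xy :: "int \<Rightarrow> int \<Rightarrow> complex \<Rightarrow> complex \<Rightarrow> complex \<Rightarrow> bool" where
  "generic_xy n p x y q \<longleftrightarrow>
     (\<forall>t\<in>{0..n-1}.
        appell_lerch_defined (g_arg n (n + p) n x y q t) (q powi (n * ((n + p)\<^sup>2 - n * n))) (-1) \<and>
        appell_lerch_defined (g_arg n (n + p) n y x q t) (q powi (n * ((n + p)\<^sup>2 - n * n))) (-1)) \<and>
     (\<forall>k\<in>{0..p-1}. theta_den n p x y q (half_shift n k) \<noteq> 0 \<and>
                    theta_den n p y x q (half_shift n k) \<noteq> 0)"

lemma half_shift_odd: "odd n \<Longrightarrow> half_shift n k = of_int k"
  by (auto simp: half_shift_def elim!: oddE)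

lemma half_shift_even: "even n \<Longrightarrow> half_shift n k = of_int k + 1 / 2"
proof -
  assume "even n"
  then obtain m where m: "n = 2 * m" by (elim evenE)
  have "frac (of_int (n - 1) / 2 :: real) = frac (of_int (m - 1) + 1 / 2)"
    by (simp add: m field_simps)
  also have "\<dots> = 1 / 2"
    by (subst frac_unique_iff) auto
  finally show ?thesis by (simp add: half_shift_def)
qed

lemma half_shift_minus: "half_shift n k - of_int (n - 1) / 2 = of_int (k - (n - 1) div 2)"
proof (cases "even n")
  case True
  then obtain m where m: "n = 2 * m" by (elim evenE)
  then have "(n - 1) div 2 = m - 1" by presburger
  then show ?thesis using True m by (simp add: half_shift_even field_simps)
next
  case False
  then show ?thesis by (auto simp: half_shift_odd elim!: oddE)
qed

lemma half_shift_plus: "half_shift n k + of_int (n + 1) / 2 = of_int (k + n div 2 + 1)"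
  by (cases "even n") (auto simp: half_shift_odd half_shift_even field_simps elim!: evenE oddE)

lemma gchoose_2_of_int: "(of_int k :: real) gchoose 2 = of_int (binom2 k)"
proof -
  have "even (k * (k - 1))" by simp
  then have "2 * binom2 k = k * (k - 1)" by (simp add: binom2_def)
  then have "2 * real_of_int (binom2 k) = of_int k * (of_int k - 1)"
    by (metis of_int_1 of_int_diff of_int_mult of_int_numeral)
  then show ?thesis by (simp add: gbinomial_prod_rev numeral_2_eq_2)
qed

lemma theta_exponent_Ints:
  fixes n p r' s' :: int
  defines "u \<equiv> half_shift n r' - of_int (n - 1) / 2" and "v \<equiv> half_shift n s' + of_int (n + 1) / 2"
  shows "of_int n * (u gchoose 2) + of_int (n + p) * u * v + of_int n * (v gchoose 2) \<in> \<int>"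
  unfolding u_def v_def half_shift_minus half_shift_plus gchoose_2_of_int by simp

lemma theta_num_exponent_Ints:
  "of_int (n * p) * (half_shift n s' - half_shift n r') \<in> \<int>"
  "of_int (p * (2 * n + p)) * (half_shift n r' + half_shift n s') + of_int (p * (n + p)) \<in> \<int>"
  by (cases "even n"; simp add: half_shift_odd half_shift_even)+

lemma theta_den_exponent_Ints:
  assumes "coprime n p"
  shows "of_int (p * (2 * n + p)) * half_shift n r' + of_int (p * (n + p)) / 2 \<in> \<int>"
proof (cases "even n")
  case True
  then obtain m where "n = 2 * m" by (elim evenE)
  then have "of_int (p * (2 * n + p)) * half_shift n r' + of_int (p * (n + p)) / 2 =
      real_of_int (p * (2 * n + p) * r' + p * (3 * m + p))"
    using True by (simp add: half_shift_even field_simps)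
  then show ?thesis by (metis Ints_of_int)
next
  case False
  then have "even (p * (n + p))" by auto
  then obtain m where "p * (n + p) = 2 * m" by (elim evenE)
  then have "of_int (p * (2 * n + p)) * half_shift n r' + of_int (p * (n + p)) / 2 =
      real_of_int (p * (2 * n + p) * r' + m)"
    using False by (simp add: half_shift_odd)
  then show ?thesis by (metis Ints_of_int)
qed

end

theory Submission
  imports Defs
begin

text \<open>
  Put \<open>b = n + p\<close>, \<open>D = b\<^sup>2 - n\<^sup>2\<close> and multiply the identity by \<open>j(-1; q\<^bsup>nD\<^esup>)\<close>. Unless one of the
  numbers \<open>z\<close> in the Appell-Lerch denominators \<open>1 - z\<close> has modulus one, every term of the identity
  becomes an absolutely convergent sum over \<open>(r, s, k) \<in> \<int>\<^sup>3\<close> of the same monomials (\<open>hecke_term\<close>),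
  with weights that are half the sum of two signs: \<open>sg r + sg s\<close> for \<open>f\<close>, \<open>sg s + \<epsilon>\<close> and
  \<open>sg r + \<epsilon>'\<close> for the two halves of \<open>g\<close>, and \<open>- \<epsilon> - \<epsilon>'\<close> for \<open>\<theta>\<close>. Here \<open>\<epsilon>\<close> and \<open>\<epsilon>'\<close> say
  whether a factor \<open>1 / (1 - z)\<close> is expanded in nonnegative or in negative powers of \<open>z\<close>. For \<open>g\<close>
  this is the geometric series, for \<open>\<theta>\<close> it is Kronecker's double series for
  \<open>j(AB) / (j(A) j(B))\<close>. So the identity holds term by term. The excluded circles are reached by
  continuity in \<open>x\<close>.
\<close>

section \<open>Summation over the integers\<close>

text \<open>The cancellation rests on one matching: at the index (r, s, k) the signs of the two
  halves of g are those of \<open>pole_arg n b x y q (n * (k - 1) - s)\<close> and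
  \<open>pole_arg n b y x q (- n * k - r)\<close>, and the theta quotients, expanded over the same
  lattice, carry the reciprocals of exactly these numbers. Off the unit circle \<open>nsg\<close> is
  odd under inversion, so their weight undoes both signs. The value -1 for z0 and z1 cancels the
  signs in the Appell-Lerch numerators and makes j(-1; Q) the sum of Q^binom(k,2), which supplies
  the third index k for f; its symmetry k -> 1 - k lets both halves of g share one lattice. The p^2
  terms of theta are residue classes: r and s, after a shift depending on k, are divided by p, and
  the quotients are the two indices of Kronecker's series. That series is classically restricted to
  |Q| < |A|, |B| < 1. Choosing the direction of expansion by the size of each Q^j A and Q^i B
  extends it to all A, B off countably many circles, so the sizes of x and y require no case
  distinction.\<close>

lemma two_binom2: "2 * binom2 k = k * (k - 1)"
proof -
  have "even (k * (k - 1))" by simp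
  then show ?thesis by (simp add: binom2_def)
qed

lemma binom2_add: "binom2 (a + b) = binom2 a + binom2 b + a * b"
proof -
  \<comment> \<open>Doubling turns \<open>binom2\<close> into a polynomial; the exponent identities
    of the later sections are checked in the same way.\<close>
  have "2 * binom2 (a + b) = 2 * (binom2 a + binom2 b + a * b)"
    unfolding distrib_left two_binom2 by (simp add: algebra_simps)
  then show ?thesis by simp
qed

lemma binom2_0 [simp]: "binom2 0 = 0" and binom2_1 [simp]: "binom2 1 = 0"
  by (auto simp: binom2_def)

lemma binom2_Suc: "binom2 (k + 1) = binom2 k + k"
  by (simp add: binom2_add)

lemma binom2_reflect: "binom2 (1 - k) = binom2 k"
proof -
  have "2 * binom2 (1 - k) = 2 * binom2 k"
    unfolding two_binom2 by (simp add: algebra_simps)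
  then show ?thesis by simp
qed

lemma sums_imp_summable_on_int:
  fixes f :: "int \<Rightarrow> real"
  assumes "summable (\<lambda>n. f (int n))" "summable (\<lambda>n. f (- int n - 1))" "\<And>k. f k \<ge> 0"
  shows "f summable_on UNIV"
proof -
  have U: "UNIV = range int \<union> range (\<lambda>n. - int n - 1)"
  proof (intro equalityI subsetI UnCI)
    fix k :: int assume "k \<notin> range (\<lambda>n. - int n - 1)"
    then have "k \<noteq> - int (nat (- k - 1)) - 1" by blast
    then have "k \<ge> 0" by (cases "k \<ge> 0") auto
    then show "k \<in> range int" by (metis nonneg_int_cases rangeI)
  qed auto
  have "(\<lambda>n. f (int n)) summable_on UNIV" "(\<lambda>n. f (- int n - 1)) summable_on UNIV"
    using assms by (simp_all add: summable_on_UNIV_nonneg_real_iff)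
  then have "f summable_on range int" "f summable_on range (\<lambda>n. - int n - 1)"
    by (subst summable_on_reindex; simp add: o_def inj_on_def)+
  then show ?thesis unfolding U by (rule summable_on_union)
qed

text \<open>Summability in \<open>complex\<close> is absolute, so the product family is summable
  without a further hypothesis.\<close>

lemma has_sum_times_complex:
  fixes f :: "'a \<Rightarrow> complex" and g :: "'b \<Rightarrow> complex"
  assumes f: "(f has_sum a) A" and g: "(g has_sum b) B"
  shows "((\<lambda>(x, y). f x * g y) has_sum (a * b)) (A \<times> B)"
proof (rule has_sum_SigmaI)
  show "((\<lambda>y. case (x, y) of (x, y) \<Rightarrow> f x * g y) has_sum f x * b) B" for x
    using has_sum_cmult_right[OF g] by simp
  show "((\<lambda>x. f x * b) has_sum a * b) A"
    by (rule has_sum_cmult_left[OF f])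
  have f': "(\<lambda>x. norm (f x)) summable_on A" and g': "(\<lambda>x. norm (g x)) summable_on B"
    using f g by (auto simp: has_sum_iff summable_on_iff_abs_summable_on_complex)
  have "(\<lambda>z. norm (case z of (x, y) \<Rightarrow> f x * g y)) summable_on A \<times> B"
    unfolding Infinite_Sum.abs_summable_on_Sigma_iff
  proof (intro conjI ballI)
    show "(\<lambda>y. norm (case (x, y) of (x, y) \<Rightarrow> f x * g y)) summable_on B" for x
      using summable_on_cmult_right[OF g', of "norm (f x)"] by (simp add: norm_mult)
    show "(\<lambda>x. norm (\<Sum>\<^sub>\<infinity>y\<in>B. norm (case (x, y) of (x, y) \<Rightarrow> f x * g y))) summable_on A"
      using summable_on_cmult_left[OF f'] infsum_nonneg[of B "\<lambda>y. norm (g y)"]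
      by (simp add: norm_mult infsum_cmult_right' abs_mult)
  qed
  then show "(\<lambda>(x, y). f x * g y) summable_on A \<times> B"
    by (simp add: summable_on_iff_abs_summable_on_complex)
qed

lemma summable_on_times_real:
  fixes f :: "'a \<Rightarrow> real" and g :: "'b \<Rightarrow> real"
  assumes "f summable_on A" "g summable_on B" "\<And>x. f x \<ge> 0" "\<And>x. g x \<ge> 0"
  shows "(\<lambda>(x, y). f x * g y) summable_on A \<times> B"
proof (rule summable_on_SigmaI)
  show "((\<lambda>y. case (x, y) of (x, y) \<Rightarrow> f x * g y) has_sum f x * infsum g B) B" for x
    using has_sum_cmult_right[OF has_sum_infsum[OF assms(2)]] by simp
  show "(\<lambda>x. f x * infsum g B) summable_on A"
    by (rule summable_on_cmult_left[OF assms(1)])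
qed (use assms in auto)

lemma has_sum_finite_Sigma:
  fixes f :: "'a \<Rightarrow> 'b \<Rightarrow> complex"
  assumes "finite I" "\<And>i. i \<in> I \<Longrightarrow> (f i has_sum a i) (B i)"
  shows "((\<lambda>(i, z). f i z) has_sum (\<Sum>i\<in>I. a i)) (Sigma I B)"
proof (rule has_sum_SigmaI)
  show "((\<lambda>y. case (i, y) of (i, z) \<Rightarrow> f i z) has_sum a i) (B i)" if "i \<in> I" for i
    using assms(2)[OF that] by simp
  show "(a has_sum (\<Sum>i\<in>I. a i)) I"
    using assms(1) by simp
  have "(\<lambda>z. norm (case z of (i, z) \<Rightarrow> f i z)) summable_on Sigma I B"
    unfolding Infinite_Sum.abs_summable_on_Sigma_iff
    using assms by (auto simp: has_sum_iff summable_on_iff_abs_summable_on_complex)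
  then show "(\<lambda>(i, z). f i z) summable_on Sigma I B"
    by (simp add: summable_on_iff_abs_summable_on_complex)
qed

text \<open>Dominated convergence for unordered sums. On the set \<open>Y\<close> where the bound
  holds, the Weierstrass test makes the finite partial sums converge uniformly, so the two limits
  may be exchanged. It serves the limit of the finite triple product and later the continuity in
  x.\<close>

lemma tendsto_infsum_dominated:
  fixes f :: "'b \<Rightarrow> 'a \<Rightarrow> complex"
  assumes bound: "\<forall>\<^sub>F n in F. \<forall>x\<in>A. norm (f n x) \<le> g x"
    and g: "g summable_on A"
    and lim: "\<And>x. x \<in> A \<Longrightarrow> ((\<lambda>n. f n x) \<longlongrightarrow> h x) F"
  shows "((\<lambda>n. infsum (f n) A) \<longlongrightarrow> infsum h A) F"
proof (cases "F = bot")
  case False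
  define Y where "Y = {n. \<forall>x\<in>A. norm (f n x) \<le> g x}"
  have "norm (h x) \<le> g x" if "x \<in> A" for x
    by (rule tendsto_upperbound[OF tendsto_norm[OF lim[OF that]] _ False])
      (use bound that in \<open>auto elim: eventually_mono\<close>)
  then have "(\<lambda>x. norm (h x)) summable_on A"
    using Infinite_Sum.abs_summable_on_comparison_test'[OF g] by blast
  then have h: "(h has_sum infsum h A) A"
    by (simp add: abs_summable_summable)
  have U: "uniform_limit Y (\<lambda>X n. \<Sum>x\<in>X. f n x) (\<lambda>n. infsum (f n) A) (finite_subsets_at_top A)"
    using Weierstrass_m_test_general[of A Y "\<lambda>x n. f n x" g, OF _ g] by (auto simp: Y_def)
  show ?thesis
  proof (rule swap_uniform_limit'[OF _ _ U])
    show "\<forall>\<^sub>F X in finite_subsets_at_top A. ((\<lambda>n. \<Sum>x\<in>X. f n x) \<longlongrightarrow> (\<Sum>x\<in>X. h x)) F"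
      by (rule eventually_finite_subsets_at_top_weakI) (auto intro!: tendsto_sum lim)
    show "((\<lambda>X. \<Sum>x\<in>X. h x) \<longlongrightarrow> infsum h A) (finite_subsets_at_top A)"
      using h by (simp add: has_sum_def)
    show "\<forall>\<^sub>F n in F. n \<in> Y"
      using bound by (simp add: Y_def)
  qed auto
qed auto

section \<open>Absolute convergence of theta series\<close>

lemma theta_series_summable_nat:
  fixes a b :: real
  assumes "0 < a" "a < 1" "b > 0"
  shows "summable (\<lambda>m. a powi binom2 (int m) * b ^ m)"
proof -
  \<comment> \<open>This is the ratio of consecutive terms, which tends to 0 however large
    \<open>b\<close> is.\<close>
  have "(\<lambda>m. a ^ m * b) \<longlonglongrightarrow> 0 * b"
    using assms by (intro tendsto_intros LIMSEQ_realpow_zero) auto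
  then have "\<forall>\<^sub>F m in sequentially. a ^ m * b < 1 / 2"
    by (rule order_tendstoD) auto
  then obtain N where N: "\<And>m. m \<ge> N \<Longrightarrow> a ^ m * b < 1 / 2"
    by (auto simp: eventually_sequentially)
  show ?thesis
  proof (rule summable_ratio_test[of "1/2" N])
    fix m assume "N \<le> m"
    have "binom2 (int (Suc m)) = binom2 (int m) + int m"
      using binom2_Suc[of "int m"] by (simp add: add.commute)
    then have "norm (a powi binom2 (int (Suc m)) * b ^ Suc m) =
        (a ^ m * b) * norm (a powi binom2 (int m) * b ^ m)"
      using assms by (simp add: power_int_add abs_mult)
    also have "\<dots> \<le> 1 / 2 * norm (a powi binom2 (int m) * b ^ m)"
      using N[OF \<open>N \<le> m\<close>] by (intro mult_right_mono) auto
    finally show "norm (a powi binom2 (int (Suc m)) * b ^ Suc m) \<le>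
        1 / 2 * norm (a powi binom2 (int m) * b ^ m)" .
  qed auto
qed

lemma theta_series_summable_real:
  fixes a b :: real
  assumes "0 < a" "a < 1" "b > 0"
  shows "(\<lambda>k. a powi binom2 k * b powi k) summable_on UNIV"
proof (rule sums_imp_summable_on_int)
  show "summable (\<lambda>m. a powi binom2 (int m) * b powi (int m))"
    using theta_series_summable_nat[OF assms] by simp
  \<comment> \<open>The negative half of the series is thus again a one-sided theta series, with
    \<open>b\<close> replaced by \<open>a\<^sup>2 / b\<close>.\<close>
  have "binom2 (- int m - 1) = binom2 (int m) + 2 * int m + 1" for m
    using binom2_reflect[of "int m + 1 + 1"] binom2_Suc[of "int m + 1"] binom2_Suc[of "int m"]
    by (simp add: algebra_simps minus_diff_commute)
  then have "a powi binom2 (- int m - 1) * b powi (- int m - 1) =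
      (a / b) * (a powi binom2 (int m) * (a\<^sup>2 / b) ^ m)" for m
    using assms by (simp add: power_int_add power_int_diff power_int_minus power_divide
        power_int_mult power2_eq_square power_mult_distrib field_simps)
  moreover have "summable (\<lambda>m. (a / b) * (a powi binom2 (int m) * (a\<^sup>2 / b) ^ m))"
    using assms by (intro summable_mult theta_series_summable_nat) auto
  ultimately show "summable (\<lambda>m. a powi binom2 (- int m - 1) * b powi (- int m - 1))"
    by simp
qed (use assms in auto)

lemma theta_series_summable:
  fixes q x :: complex
  assumes "0 < norm q" "norm q < 1" "x \<noteq> 0"
  shows "(\<lambda>k. (-1) powi k * q powi binom2 k * x powi k) summable_on UNIV"
  using theta_series_summable_real[of "norm q" "norm x"] assms
  by (simp add: summable_on_iff_abs_summable_on_complex norm_mult norm_power_int)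

text \<open>Powers are monotone in the base in a direction that depends on the sign of k. Adding
  both endpoint values gives one majorant for all k on an annulus; it is applied with endpoints
  |x|/2 and 2|x|.\<close>

lemma real_powi_between:
  fixes b c d :: real
  assumes "0 < b" "b \<le> c" "c \<le> d"
  shows "c powi k \<le> b powi k + d powi k"
proof (cases "k \<ge> 0")
  case True
  then have "c powi k \<le> d powi k"
    using assms by (intro power_int_mono) auto
  moreover have "b powi k \<ge> 0" using assms by simp
  ultimately show ?thesis by linarith
next
  case False
  then have "c powi k \<le> b powi k"
    using assms by (intro power_int_antimono) auto
  moreover have "d powi k \<ge> 0" using assms by simp
  ultimately show ?thesis by linarith
qed

section \<open>The Jacobi triple product\<close>

lemma qpoch_convergent:
  fixes q x :: complex
  assumes "norm q < 1"
  shows "convergent_prod (\<lambda>i. 1 - q ^ i * x)"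
proof (rule abs_convergent_prod_imp_convergent_prod)
  have "summable (\<lambda>i. norm q ^ i * norm x)"
    using assms by (intro summable_mult2 summable_geometric) auto
  then show "abs_convergent_prod (\<lambda>i. 1 - q ^ i * x)"
    by (simp add: abs_convergent_prod_conv_summable norm_mult norm_power)
qed

lemma qpoch_LIMSEQ:
  fixes q x :: complex
  assumes "norm q < 1"
  shows "(\<lambda>n. \<Prod>i<n. 1 - q ^ i * x) \<longlonglongrightarrow> qpoch_inf x q"
proof -
  have "(\<lambda>n. \<Prod>i\<le>n. 1 - q ^ i * x) \<longlonglongrightarrow> qpoch_inf x q"
    unfolding qpoch_inf_def by (rule convergent_prod_LIMSEQ[OF qpoch_convergent[OF assms]])
  then have "(\<lambda>n. \<Prod>i<Suc n. 1 - q ^ i * x) \<longlonglongrightarrow> qpoch_inf x q"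
    by (simp only: lessThan_Suc_atMost)
  then show ?thesis
    by (subst (asm) filterlim_sequentially_Suc)
qed

lemma qpoch_nonzero:
  fixes q x :: complex
  assumes "norm q < 1" "\<And>i. q ^ i * x \<noteq> 1"
  shows "qpoch_inf x q \<noteq> 0"
  unfolding qpoch_inf_def
  using prodinf_nonzero[OF qpoch_convergent[OF assms(1)]] assms(2) by simp

lemma power_ne_1:
  fixes q :: complex
  assumes "norm q < 1" "n > 0"
  shows "q ^ n \<noteq> 1"
proof
  assume "q ^ n = 1"
  then have "norm q ^ n = 1" by (metis norm_one norm_power)
  moreover have "norm q ^ n < 1" using assms by (simp add: power_Suc_less_one power_less_one_iff)
  ultimately show False by simp
qed

section \<open>Gaussian binomial coefficients and the finite triple product\<close>

definition qfac :: "complex \<Rightarrow> nat \<Rightarrow> complex" where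
  "qfac q m = (\<Prod>i<m. 1 - q ^ Suc i)"

lemma qfac_0 [simp]: "qfac q 0 = 1" and qfac_Suc: "qfac q (Suc m) = qfac q m * (1 - q ^ Suc m)"
  by (simp_all add: qfac_def)

lemma qfac_nonzero: "norm q < 1 \<Longrightarrow> qfac q m \<noteq> 0"
  using power_ne_1[of q] by (auto simp: qfac_def simp del: power_Suc)

lemma qpoch_self_nonzero: "norm q < 1 \<Longrightarrow> qpoch_inf q q \<noteq> 0"
  using power_ne_1[of q "Suc _"] by (intro qpoch_nonzero) (auto simp: power_commutes)

lemma qfac_LIMSEQ: "norm q < 1 \<Longrightarrow> qfac q \<longlonglongrightarrow> qpoch_inf q q"
  using qpoch_LIMSEQ[of q q] by (simp add: qfac_def[abs_def] power_commutes)

text \<open>The Gaussian binomial coefficient. The value 0 for k > m keeps Pascal's rule true at k =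
  m.\<close>

definition qbin :: "complex \<Rightarrow> nat \<Rightarrow> nat \<Rightarrow> complex" where
  "qbin q m k = (if k \<le> m then qfac q m / (qfac q k * qfac q (m - k)) else 0)"

text \<open>Over a common denominator this is 1 - q^(m+1) = (1 - q^(m-k)) + q^(m-k) (1 -
  q^(k+1)).\<close>

lemma qbin_pascal:
  assumes "norm q < 1" "k \<le> m"
  shows "qbin q (Suc m) (Suc k) = qbin q m (Suc k) + q ^ (m - k) * qbin q m k"
proof (cases "k = m")
  case True
  then show ?thesis using qfac_nonzero[OF assms(1)] by (simp add: qbin_def)
next
  case False
  then obtain d where d: "m = Suc (k + d)"
    using assms(2) by (metis add_Suc_right le_neq_implies_less less_imp_Suc_add)
  have "1 - q ^ Suc m = (1 - q ^ Suc d) + q ^ Suc d * (1 - q ^ Suc k)"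
    by (simp add: d power_add algebra_simps)
  moreover have "1 - q ^ Suc d \<noteq> 0" "1 - q ^ Suc k \<noteq> 0"
    using power_ne_1[OF assms(1), of "Suc d"] power_ne_1[OF assms(1), of "Suc k"] by auto
  ultimately show ?thesis
    using qfac_nonzero[OF assms(1), of k] qfac_nonzero[OF assms(1), of d]
    by (simp add: qbin_def d qfac_Suc divide_simps del: power_Suc)
      (simp add: algebra_simps power_add)
qed

text \<open>Multiplying by the new factor 1 + z q^m turns into Pascal's rule for the coefficients
  \<open>c\<close>, because q^(m-k) and the increment q^k of the quadratic exponent combine to
  q^m.\<close>

lemma q_binomial:
  fixes q z :: complex
  assumes "norm q < 1" "q \<noteq> 0"
  shows "(\<Prod>i<m. 1 + z * q ^ i) = (\<Sum>k\<le>m. qbin q m k * q powi binom2 (int k) * z ^ k)"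
proof (induction m)
  case 0
  then show ?case by (simp add: qbin_def)
next
  case (Suc m)
  define c where "c m k = qbin q m k * q powi binom2 (int k)" for m k
  have c: "c (Suc m) (Suc k) = c m (Suc k) + q ^ m * c m k" if "k \<le> m" for k
  proof -
    have "q ^ m = q ^ (m - k) * q ^ k" using that by (simp flip: power_add)
    moreover have "binom2 (int (Suc k)) = binom2 (int k) + int k"
      using binom2_Suc[of "int k"] by (simp add: add.commute)
    ultimately show ?thesis
      using assms by (simp add: c_def qbin_pascal[OF assms(1) that] power_int_add algebra_simps)
  qed
  have "(\<Sum>k\<le>Suc m. c (Suc m) k * z ^ k) = c (Suc m) 0 + (\<Sum>k\<le>m. c (Suc m) (Suc k) * z ^ Suc k)"
    by (subst sum.atMost_Suc_shift) simp
  also have "c (Suc m) 0 = c m 0"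
    using qfac_nonzero[OF assms(1)] by (simp add: c_def qbin_def)
  also have "(\<Sum>k\<le>m. c (Suc m) (Suc k) * z ^ Suc k) =
      (\<Sum>k\<le>m. c m (Suc k) * z ^ Suc k) + z * q ^ m * (\<Sum>k\<le>m. c m k * z ^ k)"
    by (simp add: c sum.distrib sum_distrib_left algebra_simps)
  also have "c m 0 + (\<dots>) = (\<Sum>k\<le>Suc m. c m k * z ^ k) + z * q ^ m * (\<Sum>k\<le>m. c m k * z ^ k)"
    by (subst sum.atMost_Suc_shift) simp
  also have "(\<Sum>k\<le>Suc m. c m k * z ^ k) = (\<Sum>k\<le>m. c m k * z ^ k)"
    by (simp add: c_def qbin_def)
  finally show ?case using Suc.IH by (simp add: c_def algebra_simps)
qed

lemma prod_lessThan_add: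
  fixes f :: "nat \<Rightarrow> 'a :: comm_monoid_mult"
  shows "(\<Prod>i<m + n. f i) = (\<Prod>i<m. f i) * (\<Prod>i<n. f (m + i))"
  by (induction n) (auto simp: mult.assoc)

text \<open>The Gaussian binomial coefficient of 2N over N + k, recentred so that k runs
  symmetrically about 0.\<close>

definition triple_coeff :: "complex \<Rightarrow> nat \<Rightarrow> int \<Rightarrow> complex" where
  "triple_coeff q N k = (if \<bar>k\<bar> \<le> int N
     then qfac q (2 * N) / (qfac q (nat (int N - k)) * qfac q (nat (int N + k))) else 0)"

text \<open>The q-binomial theorem with 2N factors and z = -x q^(-N). The upper N factors are the 1
  - q^i x; the lower N, in reversed order, are the 1 - q^i (q/x) up to monomials.\<close>

lemma triple_product_finite:
  fixes q x :: complex
  assumes q: "norm q < 1" "q \<noteq> 0" and x: "x \<noteq> 0"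
  shows "(\<Prod>i<N. 1 - q ^ i * x) * (\<Prod>i<N. 1 - q ^ i * (q / x)) =
    (\<Sum>k\<in>{- int N..int N}. (-1) powi k * q powi binom2 k * triple_coeff q N k * x powi k)"
proof -
  define z where "z = - x * q powi (- int N)"
  \<comment> \<open>The product of the monomials pulled out of the lower N factors; it appears on
    both sides and cancels.\<close>
  define C where "C = (- x) ^ N * q powi (- binom2 (int N + 1))"
  have C0: "C \<noteq> 0" using q x by (simp add: C_def)
  have zq: "1 + z * q ^ (N - Suc i) = (- x) * q powi (- int i - 1) * (1 - q ^ i *
    (q / x))" if "i < N" for i
  proof -
    have "q powi (- int N) * q ^ (N - Suc i) = q powi (- int N + int (N - Suc i))"
      using q by (subst power_int_add) auto
    also have "- int N + int (N - Suc i) = - int i - 1" using that by (simp add: of_nat_diff)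
    finally have "1 + z * q ^ (N - Suc i) = 1 - x * q powi (- int i - 1)"
      by (simp add: z_def mult.assoc)
    also have "\<dots> = (- x) * q powi (- int i - 1) * (1 - q ^ i * (q / x))"
      using q x by (simp add: power_int_diff power_int_minus field_simps)
    finally show ?thesis .
  qed
  have pw: "(\<Prod>i<N. (- x) * q powi (- int i - 1)) = C"
    unfolding C_def
  proof (induction N)
    case (Suc N)
    have "- binom2 (int (Suc N) + 1) = - binom2 (int N + 1) + (- int N - 1)"
      using binom2_Suc[of "int N + 1"] by (simp add: algebra_simps)
    then have e: "q powi (- binom2 (int (Suc N) + 1)) =
      q powi (- binom2 (int N + 1)) * q powi (- int N - 1)"
      using q by (metis power_int_add)
    show ?case unfolding prod.lessThan_Suc Suc e by (simp add: mult_ac)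
  qed auto
  have "(\<Prod>i<N + N. 1 + z * q ^ i) = (\<Prod>i<N. 1 + z * q ^ i) * (\<Prod>i<N. 1 + z * q ^ (N + i))"
    by (rule prod_lessThan_add)
  also have "(\<Prod>i<N. 1 + z * q ^ i) = (\<Prod>i<N. 1 + z * q ^ (N - Suc i))"
    by (rule prod.nat_diff_reindex[symmetric])
  also have "\<dots> = (\<Prod>i<N. (- x) * q powi (- int i - 1) * (1 - q ^ i * (q / x)))"
    by (rule prod.cong[OF refl], rule zq) simp
  also have "\<dots> = C * (\<Prod>i<N. 1 - q ^ i * (q / x))"
    by (simp only: prod.distrib flip: pw)
  also have "(\<Prod>i<N. 1 + z * q ^ (N + i)) = (\<Prod>i<N. 1 - q ^ i * x)"
    using q by (intro prod.cong) (auto simp: z_def power_add power_int_minus field_simps)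
  finally have L: "(\<Prod>i<N + N. 1 + z * q ^ i) =
    C * ((\<Prod>i<N. 1 - q ^ i * x) * (\<Prod>i<N. 1 - q ^ i * (q / x)))"
    by simp
  have "(\<Prod>i<N + N. 1 + z * q ^ i) = (\<Sum>k\<le>N + N. qbin q (N + N) k * q powi binom2 (int k) * z ^ k)"
    by (rule q_binomial[OF q])
  also have "\<dots> = (\<Sum>k\<in>{- int N..int N}. C * ((-1) powi k * q powi binom2 k * triple_coeff q N k *
    x powi k))"
  proof (rule sum.reindex_bij_witness[of _ "\<lambda>k. nat (k + int N)" "\<lambda>k. int k - int N"])
    fix k assume k: "k \<in> {..N + N}"
    define j where "j = int k - int N"
    have kj: "int k = j + int N" by (simp add: j_def)
    have co: "triple_coeff q N j = qbin q (N + N) k"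
    proof -
      have "nat (int N - j) = N + N - k" "nat (int N + j) = k" "\<bar>j\<bar> \<le> int N"
        using k by (auto simp: j_def)
      then show ?thesis using k by (simp add: triple_coeff_def qbin_def mult_2)
    qed
    have "z ^ k = (- x) powi (j + int N) * q powi (- int N * (j + int N))"
      by (simp only: z_def power_mult_distrib power_int_mult power_int_of_nat flip: kj)
    also have "\<dots> = (-1) powi j * x powi j * (- x) ^ N * q powi (- int N * (j + int N))"
      using x by (simp add: power_int_add power_int_minus_left power_int_minus_one_mult_self)
    finally have z: "z ^ k = (-1) powi j * x powi j * (- x) ^ N * q powi (- int N * (j + int N))" .
    have "binom2 (int k) + (- int N * (j + int N)) = binom2 j + (- binom2 (int N + 1))"
      using two_binom2[of "int N"] unfolding kj binom2_add by (simp add: algebra_simps)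
    then have "q powi binom2 (int k) * q powi (- int N * (j + int N)) =
      q powi binom2 j * q powi (- binom2 (int N + 1))"
      using q by (metis power_int_add)
    then show "C * ((- 1) powi (int k - int N) * q powi binom2 (int k - int N) *
      triple_coeff q N (int k - int N) *
          x powi (int k - int N)) = qbin q (N + N) k * q powi binom2 (int k) * z ^ k"
      unfolding j_def[symmetric] co z C_def by (simp add: mult_ac)
  qed (auto simp: nat_le_iff)
  also have "\<dots> = C * (\<Sum>k\<in>{- int N..int N}. (-1) powi k * q powi binom2 k * triple_coeff q N k *
    x powi k)"
    by (rule sum_distrib_left[symmetric])
  finally show ?thesis using L C0 by simp
qed

section \<open>The limit of the finite triple product\<close>

lemma triple_coeff_bounded:
  assumes "norm q < 1"
  obtains C where "\<And>N k. norm (triple_coeff q N k) \<le> C"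
proof -
  \<comment> \<open>The finite products (q;q)_n converge to a nonzero limit, so both they and their
    inverses are bounded. This gives a bound uniform in N and k, as dominated convergence
    requires.\<close>
  have "(\<lambda>n. inverse (qfac q n)) \<longlonglongrightarrow> inverse (qpoch_inf q q)"
    using qfac_LIMSEQ[OF assms] qpoch_self_nonzero[OF assms] by (rule tendsto_inverse)
  then have "Bseq (\<lambda>n. inverse (qfac q n))" "Bseq (qfac q)"
    using qfac_LIMSEQ[OF assms] by (auto intro!: convergent_imp_Bseq convergentI)
  then obtain K L where K: "K > 0" "\<And>n. norm (inverse (qfac q n)) \<le>
    K" and L: "L > 0" "\<And>n. norm (qfac q n) \<le> L"
    by (auto elim!: BseqE)
  have "norm (triple_coeff q N k) \<le> L * (K * K)" for N k
  proof (cases "\<bar>k\<bar> \<le> int N")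
    case True
    then have "norm (triple_coeff q N k) = norm (qfac q (2 * N)) *
        (norm (inverse (qfac q (nat (int N - k)))) * norm (inverse (qfac q (nat (int N + k)))))"
      by (simp add: triple_coeff_def norm_mult norm_divide norm_inverse field_simps)
    also have "\<dots> \<le> L * (K * K)"
      using K L by (intro mult_mono) auto
    finally show ?thesis .
  qed (use K L in \<open>auto simp: triple_coeff_def\<close>)
  then show ?thesis by (rule that)
qed

lemma triple_coeff_LIMSEQ:
  assumes "norm q < 1"
  shows "(\<lambda>N. triple_coeff q N k) \<longlonglongrightarrow> 1 / qpoch_inf q q"
proof -
  have A: "filterlim (\<lambda>N. nat (int N + j)) sequentially sequentially" for j :: int
    unfolding filterlim_at_top eventually_sequentially
  proof
    fix Z :: nat
    show "\<exists>N. \<forall>n\<ge>N. Z \<le> nat (int n + j)"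
      by (rule exI[of _ "nat (int Z - j)"]) auto
  qed
  have B: "filterlim (\<lambda>N::nat. 2 * N) sequentially sequentially"
    by (rule mult_nat_left_at_top) simp
  note lim = filterlim_compose[OF qfac_LIMSEQ[OF assms]]
  have "(\<lambda>N. qfac q (2 * N) / (qfac q (nat (int N + (- k))) * qfac q (nat (int N + k))))
      \<longlonglongrightarrow> qpoch_inf q q / (qpoch_inf q q * qpoch_inf q q)"
    using qpoch_self_nonzero[OF assms] by (intro tendsto_intros lim A B) auto
  moreover have "\<forall>\<^sub>F N in sequentially. qfac q (2 * N) / (qfac q (nat (int N + (- k))) *
    qfac q (nat (int N + k))) = triple_coeff q N k"
    using eventually_ge_at_top[of "nat \<bar>k\<bar>"] by eventually_elim (auto simp: triple_coeff_def)
  ultimately show ?thesis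
    using qpoch_self_nonzero[OF assms] by (simp add: tendsto_cong)
qed

text \<open>Stated for general \<open>a\<close> because it is used twice: for the triple product,
  and with an extra factor k for its derivative at 1.\<close>

lemma triple_coeff_infsum_LIMSEQ:
  fixes a :: "int \<Rightarrow> complex"
  assumes "norm q < 1" "a summable_on UNIV"
  shows "(\<lambda>N. \<Sum>k\<in>{- int N..int N}. a k * triple_coeff q N k) \<longlonglongrightarrow> infsum a UNIV / qpoch_inf q q"
proof -
  obtain C where C: "\<And>N k. norm (triple_coeff q N k) \<le> C"
    using triple_coeff_bounded[OF assms(1)] by blast
  have "(\<Sum>k\<in>{- int N..int N}. a k * triple_coeff q N k) =
    infsum (\<lambda>k. a k * triple_coeff q N k) UNIV" for N
    by (rule infsumI[symmetric], rule has_sum_finite_neutralI[of "{- int N..int N}"])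
      (auto simp: triple_coeff_def)
  moreover have "(\<lambda>N. infsum (\<lambda>k. a k * triple_coeff q N k) UNIV) \<longlonglongrightarrow>
    infsum (\<lambda>k. a k * (1 / qpoch_inf q q)) UNIV"
  proof (rule tendsto_infsum_dominated)
    show "\<forall>\<^sub>F N in sequentially. \<forall>k\<in>UNIV. norm (a k * triple_coeff q N k) \<le> norm (a k) * C"
      by (auto simp: norm_mult intro!: always_eventually mult_left_mono C)
    show "(\<lambda>k. norm (a k) * C) summable_on UNIV"
      using assms(2) by (intro summable_on_cmult_left) (simp add:
        summable_on_iff_abs_summable_on_complex)
  qed (intro tendsto_intros triple_coeff_LIMSEQ[OF assms(1)])
  ultimately show ?thesis
    by (simp only: infsum_cmult_left') simp
qed

lemma jacobi_triple_product:
  assumes "0 < norm q" "norm q < 1" "x \<noteq> 0"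
  shows "((\<lambda>k. (-1) powi k * q powi binom2 k * x powi k) has_sum jtheta x q) UNIV"
proof -
  define a where "a k = (-1) powi k * q powi binom2 k * x powi k" for k
  have sm: "a summable_on UNIV"
    unfolding a_def by (rule theta_series_summable[OF assms])
  have "(\<lambda>N. (\<Prod>i<N. 1 - q ^ i * x) * (\<Prod>i<N. 1 - q ^ i * (q / x))) \<longlonglongrightarrow>
    qpoch_inf x q * qpoch_inf (q / x) q"
    by (intro tendsto_mult qpoch_LIMSEQ assms)
  moreover have "(\<lambda>N. (\<Prod>i<N. 1 - q ^ i * x) * (\<Prod>i<N. 1 - q ^ i * (q / x))) \<longlonglongrightarrow>
    infsum a UNIV / qpoch_inf q q"
    using triple_coeff_infsum_LIMSEQ[OF assms(2) sm] assms
    by (subst triple_product_finite) (auto simp: a_def mult_ac)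
  ultimately have "qpoch_inf x q * qpoch_inf (q / x) q = infsum a UNIV / qpoch_inf q q"
    by (rule LIMSEQ_unique)
  then have "jtheta x q = infsum a UNIV"
    using qpoch_self_nonzero[OF assms(2)] by (simp add: jtheta_def field_simps)
  then show ?thesis using sm unfolding a_def by simp
qed

text \<open>Absorbs the factor k of \<open>jacobi_cube\<close> into two theta series, with arguments
  2 and 1/2.\<close>

lemma abs_le_two_powi: "\<bar>real_of_int k\<bar> \<le> 2 powi k + (1 / 2) powi k"
proof -
  have *: "real n \<le> 2 ^ n" for n by (simp add: of_nat_less_two_power less_imp_le)
  show ?thesis
  proof (cases k)
    case (nonneg n)
    have "(1 / 2 :: real) ^ n \<ge> 0" by simp
    then have "real n \<le> 2 ^ n + (1 / 2) ^ n" using *[of n] by linarith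
    then show ?thesis using nonneg by simp
  next
    case (neg n)
    have "(1 / 2 :: real) powi k = 2 ^ Suc n" unfolding neg
      by (simp only: power_int_minus power_int_of_nat) (simp add: power_one_over field_simps)
    moreover have "(2 :: real) powi k \<ge> 0" by simp
    moreover have "\<bar>real_of_int k\<bar> = real (Suc n)" using neg by simp
    ultimately show ?thesis using *[of "Suc n"] by linarith
  qed
qed

text \<open>The derivative at \<open>x = 1\<close> of the finite triple product, in the limit.\<close>

lemma jacobi_cube:
  assumes "0 < norm q" "norm q < 1"
  shows "((\<lambda>k. of_int k * (-1) powi k * q powi binom2 k) has_sum - (qpoch_inf q q ^ 3)) UNIV"
proof -
  define a where "a k = (-1) powi k * q powi binom2 k" for k
  have q0: "q \<noteq> 0" using assms by auto
  have "(\<lambda>k. norm q powi binom2 k * 2 powi k + norm q powi binom2 k *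
    (1 / 2) powi k) summable_on UNIV"
    using assms by (intro summable_on_add theta_series_summable_real) auto
  then have "(\<lambda>k. norm (of_int k * a k)) summable_on UNIV"
  proof (rule summable_on_comparison_test)
    fix k
    show "norm (of_int k * a k) \<le> norm q powi binom2 k * 2 powi k + norm q powi binom2 k *
      (1 / 2) powi k"
      using mult_left_mono[OF abs_le_two_powi[of k], of "norm q powi binom2 k"]
      by (simp add: a_def norm_mult norm_power_int algebra_simps)
  qed auto
  then have sm: "(\<lambda>k. of_int k * a k) summable_on UNIV"
    by (simp add: summable_on_iff_abs_summable_on_complex)
  have *: "(\<Sum>k\<in>{- int (Suc N)..int (Suc N)}. (of_int k * a k) * triple_coeff q (Suc N) k) =
    - (qfac q N * qfac q (Suc N))" for N
  proof -
    \<comment> \<open>With Suc N factors the first product contains 1 - x; \<open>R\<close> is what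
      is left of the finite triple product after this factor is removed, so the derivative at 1 is -
      R 1.\<close>
    define R where "R x = (\<Prod>i<N. 1 - q ^ Suc i * x) * (\<Prod>i<Suc N. 1 - q ^ i * (q / x))" for x
    define L where "L x = (\<Sum>k\<in>{- int (Suc N)..int (Suc N)}. a k * triple_coeff q (Suc N) k *
      x powi k)" for x
    have L: "L x = (1 - x) * R x" if "x \<noteq> 0" for x
      using triple_product_finite[OF assms(2) q0 that, of "Suc N"]
      by (simp add: L_def a_def R_def prod.lessThan_Suc_shift mult.assoc del: prod.lessThan_Suc
        power_Suc)
    have "isCont R 1"
      unfolding R_def by (intro continuous_intros) auto
    then have "((\<lambda>x. (1 - x) * R x) has_field_derivative - R 1) (at 1)"
      \<comment> \<open>Caratheodory's form of the derivative asks only for continuity of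
        \<open>R\<close> at 1.\<close>
      unfolding CARAT_DERIV by (intro exI[of _ "\<lambda>x. - R x"]) (auto simp: algebra_simps)
    then have "(L has_field_derivative - R 1) (at 1)"
      by (rule has_field_derivative_transform_within_open[of _ _ _ "- {0}"]) (auto simp: L)
    moreover have "(L has_field_derivative (\<Sum>k\<in>{- int (Suc N)..int (Suc N)}. a k *
      triple_coeff q (Suc N) k * of_int k)) (at 1)"
      unfolding L_def by (auto intro!: derivative_eq_intros simp: mult_ac)
    ultimately have "(\<Sum>k\<in>{- int (Suc N)..int (Suc N)}. a k * triple_coeff q (Suc N) k *
      of_int k) = - R 1"
      by (rule DERIV_unique[symmetric])
    moreover have "R 1 = qfac q N * qfac q (Suc N)"
      by (simp add: R_def qfac_def power_commutes)
    ultimately show ?thesis by (simp only: mult.commute mult.left_commute mult.assoc)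
  qed
  have "(\<lambda>N. \<Sum>k\<in>{- int (Suc N)..int (Suc N)}. (of_int k * a k) * triple_coeff q (Suc N) k) \<longlonglongrightarrow>
    infsum (\<lambda>k. of_int k * a k) UNIV / qpoch_inf q q"
    using triple_coeff_infsum_LIMSEQ[OF assms(2) sm] by (rule LIMSEQ_Suc)
  moreover have "(\<lambda>N. - (qfac q N * qfac q (Suc N))) \<longlonglongrightarrow> - (qpoch_inf q q * qpoch_inf q q)"
    using qfac_LIMSEQ[OF assms(2)] by (intro tendsto_intros LIMSEQ_Suc)
  ultimately have "infsum (\<lambda>k. of_int k * a k) UNIV / qpoch_inf q q =
    - (qpoch_inf q q * qpoch_inf q q)"
    unfolding * by (rule LIMSEQ_unique)
  then have "infsum (\<lambda>k. of_int k * a k) UNIV = - (qpoch_inf q q ^ 3)"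
    using qpoch_self_nonzero[OF assms(2)] by (simp add: field_simps power3_eq_cube)
  then show ?thesis using sm by (metis (no_types,
    lifting) a_def has_sum_cong has_sum_infsum mult.assoc)
qed

text \<open>Grouping the factors of (Q;Q) by their index modulo 3 gives (Q;Q^3), (Q^2;Q^3) and
  (Q^3;Q^3), the three factors of j(Q; Q^3).\<close>

lemma J1_eq_qpoch:
  assumes "0 < norm q" "norm q < 1" "m > 0"
  shows "J1 m q = qpoch_inf (q powi m) (q powi m)"
proof -
  define Q where "Q = q powi m"
  have Q: "Q \<noteq> 0" "norm Q < 1"
    using assms power_int_strict_decreasing[of 0 m "norm q"] by (auto simp: Q_def norm_power_int)
  have fin: "(\<Prod>i<3 * n. 1 - Q ^ i * Q) =
      (\<Prod>i<n. 1 - (Q ^ 3) ^ i * Q) * (\<Prod>i<n. 1 - (Q ^ 3) ^ i * Q\<^sup>2) * (\<Prod>i<n. 1 - (Q ^ 3) ^ i *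
        Q ^ 3)" for n
  proof (induction n)
    case (Suc n)
    have "3 * Suc n = Suc (Suc (Suc (3 * n)))" by simp
    moreover have "Q ^ (3 * n) = (Q ^ 3) ^ n" by (simp add: power_mult)
    ultimately show ?case
      unfolding prod.lessThan_Suc \<open>3 * Suc n = _\<close> Suc power_Suc \<open>Q ^ (3 * n) = _\<close>
      by (simp add: power2_eq_square power3_eq_cube mult_ac)
  qed auto
  have "norm (Q ^ 3) < 1"
    using Q by (simp add: norm_power power_less_one_iff)
  then have "(\<lambda>n. \<Prod>i<3 * n. 1 - Q ^ i * Q) \<longlonglongrightarrow> qpoch_inf Q (Q ^ 3) * qpoch_inf (Q\<^sup>2) (Q ^ 3) *
    qpoch_inf (Q ^ 3) (Q ^ 3)"
    unfolding fin by (intro tendsto_mult qpoch_LIMSEQ)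
  moreover have "(\<lambda>n. \<Prod>i<3 * n. 1 - Q ^ i * Q) \<longlonglongrightarrow> qpoch_inf Q Q"
    by (rule filterlim_compose[OF qpoch_LIMSEQ[OF Q(2)]]) (rule mult_nat_left_at_top, simp)
  ultimately have "qpoch_inf Q Q = qpoch_inf Q (Q ^ 3) * qpoch_inf (Q\<^sup>2) (Q ^ 3) *
    qpoch_inf (Q ^ 3) (Q ^ 3)"
    using LIMSEQ_unique by blast
  moreover have "q powi (3 * m) = Q ^ 3"
    by (subst mult.commute) (simp add: Q_def power_int_mult)
  moreover have "Q ^ 3 / Q = Q\<^sup>2"
    using Q by (simp add: power2_eq_square power3_eq_cube)
  ultimately show ?thesis
    by (simp add: J1_def J2_def jtheta_def flip: Q_def)
qed

section \<open>Signs and distance to the poles\<close>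

text \<open>The sign \<open>\<epsilon>\<close> of the overview, as a function of z.\<close>

definition nsg :: "complex \<Rightarrow> int" where
  "nsg z = (if norm z < 1 then 1 else -1)"

lemma nsg_inverse: "z \<noteq> 0 \<Longrightarrow> norm z \<noteq> 1 \<Longrightarrow> nsg (inverse z) = - nsg z"
  by (auto simp: nsg_def norm_inverse inverse_less_1_iff)

lemma powi_escape:
  fixes a c :: real
  assumes "0 < a" "a < 1" "c > 0"
  obtains N :: nat where "\<And>k. k \<ge> int N \<Longrightarrow> a powi k * c \<le> 1 / 2" "\<And>k. k \<le> - int N \<Longrightarrow> a powi k * c \<ge> 2"
proof -
  have "(\<lambda>n. a ^ n * c) \<longlonglongrightarrow> 0 * c" "(\<lambda>n. a ^ n / c) \<longlonglongrightarrow> 0 / c"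
    using assms by (intro tendsto_intros LIMSEQ_realpow_zero; simp)+
  then have "\<forall>\<^sub>F n in sequentially. a ^ n * c < 1 / 2 \<and> a ^ n / c < 1 / 2"
    by (intro eventually_conj; elim order_tendstoD) auto
  then obtain N where N: "a ^ N * c < 1 / 2" "a ^ N / c < 1 / 2"
    by (auto simp: eventually_sequentially)
  show thesis
  proof (rule that[of N])
    fix k :: int assume "k \<ge> int N"
    then have "a powi k \<le> a powi (int N)" using assms by (intro power_int_decreasing) auto
    then have "a powi k * c \<le> a ^ N * c" using assms by (intro mult_right_mono) auto
    then show "a powi k * c \<le> 1 / 2" using N by linarith
  next
    fix k :: int assume "k \<le> - int N"
    then have "a powi (- int N) \<le> a powi k" using assms by (intro power_int_decreasing) auto
    then have "a powi (- int N) * c \<le> a powi k * c" using assms by (intro mult_right_mono) auto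
    moreover have "a powi (- int N) * c > 2"
      using N assms by (simp add: power_int_minus field_simps)
    ultimately show "a powi k * c \<ge> 2" by linarith
  qed
qed

text \<open>Only finitely many q^k z lie near the unit circle. The factor 1 + |q|^k, in place of a
  mere constant, makes the bound stable: moving z by d moves q^k z by |q|^k d, so one d works for
  all k at once.\<close>

lemma pole_distance:
  fixes q z :: complex
  assumes q: "0 < norm q" "norm q < 1" and z: "z \<noteq> 0" "\<And>k::int. q powi k * z \<noteq> 1"
  obtains c where "c > 0" "\<And>k::int. norm (1 - q powi k * z) \<ge> c * (1 + norm q powi k)"
proof -
  have z0: "norm z > 0" using z by simp
  obtain N where N: "\<And>k. k \<ge> int N \<Longrightarrow> norm q powi k * norm z \<le> 1 / 2"
      "\<And>k. k \<le> - int N \<Longrightarrow> norm q powi k * norm z \<ge> 2"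
    using powi_escape[OF q z0] by blast
  define r where "r k = norm (1 - q powi k * z) / (1 + norm q powi k)" for k :: int
  \<comment> \<open>The minimum over the window handles the finitely many critical k. Above it |q^k
    z| \<le> 1/2 and 1 + |q|^k \<le> 2, whence 1/4; below it |q^k z| \<ge> 2 and 1 + |q|^k \<le> 2
    |q|^k, whence |z|/4.\<close>
  define c where "c = min (Min (r ` {- int N..int N})) (min (1 / 4) (norm z / 4))"
  have pos: "norm q powi k > 0" for k using q by simp
  then have pos': "1 + norm q powi k > 0" for k by (simp add: add_pos_pos)
  have "r k > 0" for k using z(2)[of k] pos'[of k] by (auto simp: r_def)
  then have c0: "c > 0" using z0 by (auto simp: c_def)
  have main: "norm (1 - q powi k * z) \<ge> c * (1 + norm q powi k)" for k
  proof -
    consider "k \<in> {- int N..int N}" | "k > int N" | "k < - int N" by fastforce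
    then show ?thesis
    proof cases
      case 1
      then have "c \<le> r k" by (auto simp: c_def intro!: min.coboundedI1 Min_le)
      then show ?thesis using pos'[of k] by (simp add: r_def pos_le_divide_eq)
    next
      case 2
      then have "norm q powi k \<le> 1" using power_int_decreasing[of 0 k "norm q"] q by simp
      then have "c * (1 + norm q powi k) \<le> 1 / 4 * 2"
        using pos'[of k] by (intro mult_mono) (auto simp: c_def)
      moreover have "norm (1 - q powi k * z) \<ge> 1 - norm (q powi k * z)"
        by (metis norm_one norm_triangle_ineq2)
      ultimately show ?thesis using N(1)[of k] 2 by (simp add: norm_mult norm_power_int)
    next
      case 3
      then have 1: "1 \<le> norm q powi k" using power_int_decreasing[of k 0 "norm q"] q by simp
      have "c * (1 + norm q powi k) \<le> norm z / 4 * (2 * norm q powi k)"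
        using 1 z0 by (intro mult_mono) (auto simp: c_def)
      then have "c * (1 + norm q powi k) \<le> norm q powi k * norm z / 2" by (simp add: mult_ac)
      moreover have "norm (1 - q powi k * z) \<ge> norm (q powi k * z) - 1"
        by (metis norm_minus_commute norm_one norm_triangle_ineq2)
      moreover have "norm (q powi k * z) = norm q powi k * norm z"
        by (simp add: norm_mult norm_power_int)
      ultimately show ?thesis using N(2)[of k] 3 by linarith
    qed
  qed
  show thesis by (rule that[OF c0 main])
qed

text \<open>|q^k z| decreases in k, so the sign changes exactly once. This turns a condition on
  norms into the sign of a shifted integer, on which lattice substitutions can act.\<close>

lemma nsg_threshold:
  fixes q z :: complex
  assumes q: "0 < norm q" "norm q < 1" and z: "z \<noteq> 0" "\<And>k::int. norm (q powi k * z) \<noteq> 1"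
  obtains M where "\<And>k. nsg (q powi k * z) = sg (k - M)"
proof -
  have z0: "norm z > 0" using z by simp
  obtain N where N: "\<And>k. k \<ge> int N \<Longrightarrow> norm q powi k * norm z \<le> 1 / 2"
      "\<And>k. k \<le> - int N \<Longrightarrow> norm q powi k * norm z \<ge> 2"
    using powi_escape[OF q z0] by blast
  define P where "P k \<longleftrightarrow> norm q powi k * norm z < 1" for k
  have mono: "P k'" if "P k" "k \<le> k'" for k k'
    using mult_right_mono[OF power_int_decreasing[OF that(2)], of "norm q" "norm z"] q that(1)
      by (auto simp: P_def)
  define L where "L = (LEAST n. P (int n - int N))"
  have PL: "P (int L - int N)"
    unfolding L_def by (rule LeastI[of _ "2 * N"]) (use N(1)[of "int N"] in \<open>simp add: P_def\<close>)
  have "P k \<longleftrightarrow> k \<ge> int L - int N" for k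
  proof
    assume k: "P k"
    show "k \<ge> int L - int N"
    proof (rule ccontr)
      assume *: "\<not> k \<ge> int L - int N"
      have "k > - int N" using N(2)[of k] k by (force simp: P_def)
      then have "P (int (nat (k + int N)) - int N)" using k by simp
      then have "L \<le> nat (k + int N)" unfolding L_def by (rule Least_le)
      with * \<open>k > - int N\<close> show False by linarith
    qed
  qed (use PL mono in blast)
  then have "nsg (q powi k * z) = sg (k - (int L - int N))" for k
    by (auto simp: nsg_def sg_def P_def norm_mult norm_power_int)
  then show thesis by (rule that)
qed

section \<open>Kronecker's double series\<close>

lemma sum_powi_geometric:
  fixes t :: complex
  assumes "t \<noteq> 0"
  shows "(\<Sum>l\<in>{b..<b + int n}. t powi l) * (1 - t) = t powi b - t powi (b + int n)"
proof (induction n)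
  case (Suc n)
  have "{b..<b + int (Suc n)} = insert (b + int n) {b..<b + int n}" by auto
  then have "(\<Sum>l\<in>{b..<b + int (Suc n)}. t powi l) =
    t powi (b + int n) + (\<Sum>l\<in>{b..<b + int n}. t powi l)"
    by simp
  moreover have "t powi (b + int (Suc n)) = t powi (b + int n) * t"
    using assms power_int_add_1[of t "b + int n"] by (simp add: add_ac)
  ultimately show ?case using Suc by (simp only: distrib_right) (simp add: algebra_simps)
qed auto

text \<open>The weight is 1 for \<beta> \<le> l \<le> \<alpha>, it is -1 for \<alpha> < l < \<beta>,
  and 0 otherwise. This is the usual convention for a sum from \<beta> to \<alpha> with limits in
  either order, and it is why the closed forms of the next two lemmas need no assumption on the
  order.\<close>

lemma signed_interval_sum:
  fixes f :: "int \<Rightarrow> complex"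
  shows "\<alpha> = \<beta> - 1 + int n \<Longrightarrow>
      ((\<lambda>l. of_int (sg (\<alpha> - l) + sg (l - \<beta>)) / 2 * f l) has_sum (\<Sum>l\<in>{\<beta>..<\<beta> + int n}. f l)) UNIV"
    "\<beta> = \<alpha> + 1 + int n \<Longrightarrow>
      ((\<lambda>l. of_int (sg (\<alpha> - l) + sg (l - \<beta>)) / 2 * f l) has_sum
        - (\<Sum>l\<in>{\<alpha> + 1..<\<alpha> + 1 + int n}. f l)) UNIV"
  unfolding sum_negf[symmetric]
  by (rule has_sum_finite_neutralI[of "{\<beta>..<\<beta> + int n}"]; auto simp: sg_def intro!: sum.cong)
    (rule has_sum_finite_neutralI[of "{\<alpha> + 1..<\<alpha> + 1 + int n}"]; auto simp: sg_def intro!: sum.cong)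

lemma signed_geometric_sum:
  fixes t :: complex
  assumes "t \<noteq> 0" "t \<noteq> 1"
  shows "((\<lambda>l. of_int (sg (\<alpha> - l) + sg (l - \<beta>)) / 2 * t powi l) has_sum
    (t powi \<beta> - t powi (\<alpha> + 1)) / (1 - t)) UNIV"
proof (cases "\<alpha> \<ge> \<beta> - 1")
  case True
  then obtain n where n: "\<alpha> = \<beta> - 1 + int n" by (metis zle_iff_zadd)
  have "(\<Sum>l\<in>{\<beta>..<\<beta> + int n}. t powi l) = (t powi \<beta> - t powi (\<alpha> + 1)) / (1 - t)"
    using sum_powi_geometric[OF assms(1), of \<beta> n] assms(2) by (simp add: n field_simps)
  then show ?thesis using signed_interval_sum(1)[OF n, of "\<lambda>l. t powi l"] by simp
next
  case False
  then have "\<alpha> + 1 \<le> \<beta>" by simp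
  then obtain n where n: "\<beta> = \<alpha> + 1 + int n" by (metis zle_iff_zadd)
  have "- (\<Sum>l\<in>{\<alpha> + 1..<\<alpha> + 1 + int n}. t powi l) = (t powi \<beta> - t powi (\<alpha> + 1)) / (1 - t)"
    using sum_powi_geometric[OF assms(1), of "\<alpha> + 1" n] assms(2) by (simp add: n field_simps)
  then show ?thesis using signed_interval_sum(2)[OF n, of "\<lambda>l. t powi l"] by simp
qed

lemma signed_count_sum:
  "((\<lambda>l. of_int (sg (\<alpha> - l) + sg (l - \<beta>)) / 2) has_sum (of_int (\<alpha> - \<beta> + 1) :: complex)) UNIV"
proof (cases "\<alpha> \<ge> \<beta> - 1")
  case True
  then obtain n where n: "\<alpha> = \<beta> - 1 + int n" by (metis zle_iff_zadd)
  then show ?thesis using signed_interval_sum(1)[OF n, of "\<lambda>_. 1"] by simp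
next
  case False
  then have "\<alpha> + 1 \<le> \<beta>" by simp
  then obtain n where n: "\<beta> = \<alpha> + 1 + int n" by (metis zle_iff_zadd)
  then show ?thesis using signed_interval_sum(2)[OF n, of "\<lambda>_. 1"] by simp
qed

text \<open>The reflection \<open>w \<mapsto> 1 - 2 m - w\<close> fixes the exponent and flips the sign.\<close>

lemma theta_series_vanishes:
  fixes q :: complex
  assumes "0 < norm q" "norm q < 1"
  shows "((\<lambda>w. (-1) powi w * q powi (binom2 w + m * w)) has_sum 0) UNIV"
proof -
  have q0: "q \<noteq> 0" using assms by auto
  define S where "S = jtheta (q powi m) q"
  have S: "((\<lambda>w. (-1) powi w * q powi (binom2 w + m * w)) has_sum S) UNIV"
    using jacobi_triple_product[OF assms, of "q powi m"] q0
    by (simp add: S_def power_int_add power_int_mult mult.assoc)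
  have e: "binom2 (1 - 2 * m - w) + m * (1 - 2 * m - w) = binom2 w + m * w" for w
  proof -
    have "2 * (binom2 (1 - 2 * m - w) + m * (1 - 2 * m - w)) = 2 * (binom2 w + m * w)"
      unfolding distrib_left two_binom2 by (simp add: algebra_simps)
    then show ?thesis by simp
  qed
  have p: "(-1 :: complex) powi (1 - 2 * m - w) = - ((-1) powi w)" for w
    by (auto simp: power_int_minus_left)
  have "((\<lambda>w. (-1) powi w * q powi (binom2 w + m * w)) has_sum S) UNIV \<longleftrightarrow>
      ((\<lambda>w. - ((-1) powi w * q powi (binom2 w + m * w))) has_sum S) UNIV"
    by (rule has_sum_reindex_bij_witness[of _ "\<lambda>w. 1 - 2 * m - w" "\<lambda>w. 1 - 2 *
      m - w"]) (auto simp: e p)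
  with S have "((\<lambda>w. - ((-1) powi w * q powi (binom2 w + m * w))) has_sum S) UNIV" by simp
  moreover have "((\<lambda>w. - ((-1) powi w * q powi (binom2 w + m * w))) has_sum - S) UNIV"
    by (rule has_sum_uminusI[OF S])
  ultimately have "S = - S" by (rule has_sum_unique)
  then show ?thesis using S by simp
qed

text \<open>The weight vanishes unless i and j have the same sign. If both are nonnegative, |q^(ij)|
  \<le> 1 leaves geometric series in |A| and |B|. If both are negative, (i+1)(j+1) \<ge> 0 gives
  |q|^(ij) \<le> |q|^(-i-j-1), which leaves geometric series in |q|/|A| and |q|/|B| and costs the
  factor 1/|q|.\<close>

lemma reciprocal_theta_summable_annulus:
  fixes q A B :: complex
  assumes q: "0 < norm q" and A: "norm q < norm A" "norm A < 1" and
    B: "norm q < norm B" "norm B < 1"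
  shows "(\<lambda>(i, j). of_int (sg j + sg i) / 2 * q powi (i * j) * A powi i *
    B powi j) summable_on UNIV"
proof -
  define u where "u c i = (if i \<ge> 0 then norm c powi i else (norm q / norm c) powi (- i))" for c
    :: complex and i :: int
  have u0: "u c i \<ge> 0" for c i using q by (auto simp: u_def)
  have u: "u c summable_on UNIV" if "norm q < norm c" "norm c < 1" for c
  proof (rule sums_imp_summable_on_int)
    show "summable (\<lambda>n. u c (int n))"
      using that by (simp add: u_def summable_geometric)
    have "- (- int n - 1) = int (Suc n)" for n by simp
    then have "u c (- int n - 1) = (norm q / norm c) ^ Suc n" for n
      unfolding u_def by (simp only: power_int_of_nat) simp
    moreover have "summable (\<lambda>n. (norm q / norm c) ^ Suc n)"
    proof -
      have "norm c > 0" using that q by linarith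
      then show ?thesis
        using that by (subst summable_Suc_iff, intro summable_geometric) (simp add: norm_divide)
    qed
    ultimately show "summable (\<lambda>n. u c (- int n - 1))" by simp
  qed (rule u0)
  have "(\<lambda>(i, j). u A i * u B j) summable_on UNIV \<times> UNIV"
    by (rule summable_on_times_real[OF u[OF A] u[OF B] u0 u0])
  then have sm: "(\<lambda>z. (1 / norm q) * (case z of (i, j) \<Rightarrow> u A i * u B j)) summable_on UNIV"
    by (subst (asm) UNIV_Times_UNIV) (rule summable_on_cmult_right)
  have "(\<lambda>z. norm (case z of (i, j) \<Rightarrow> of_int (sg j + sg i) / 2 * q powi (i * j) * A powi i *
    B powi j)) summable_on UNIV"
  proof (rule summable_on_comparison_test[OF sm])
    fix z :: "int \<times> int"
    obtain i j where z: "z = (i, j)" by (cases z)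
    have q1: "norm q < 1" using A by simp
    consider "i \<ge> 0" "j \<ge> 0" | "i < 0" "j < 0" | "sg j + sg i = 0"
      by (cases "i \<ge> 0"; cases "j \<ge> 0") (auto simp: sg_def)
    then have "norm (of_int (sg j + sg i) / 2 * q powi (i * j) * A powi i * B powi j) \<le>
      1 / norm q * (u A i * u B j)"
    proof cases
      case 1
      then have "i * j \<ge> 0" by simp
      then have "norm q powi (i * j) \<le> 1" using power_int_decreasing[of 0 "i * j" "norm q"] q q1
        by simp
      also have "\<dots> \<le> 1 / norm q" using q q1 by simp
      finally have "norm q powi (i * j) * (norm A powi i * norm B powi j) \<le>
        1 / norm q * (norm A powi i * norm B powi j)"
        by (rule mult_right_mono) simp
      then show ?thesis using 1 by (simp add: sg_def u_def norm_mult norm_power_int mult.assoc)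
    next
      case 2
      have "(i + 1) * (j + 1) \<ge> 0" using 2 by (intro mult_nonpos_nonpos) auto
      then have "norm q powi (i * j) \<le> norm q powi (- i + (- j) - 1)"
        using q q1 by (intro power_int_decreasing) (auto simp: algebra_simps)
      also have "\<dots> = 1 / norm q * (norm q powi (- i) * norm q powi (- j))"
        using q by (simp add: power_int_add power_int_diff power_int_minus field_simps)
      finally have "norm q powi (i * j) * (norm A powi i * norm B powi j) \<le>
          1 / norm q * (norm q powi (- i) * norm q powi (- j)) * (norm A powi i * norm B powi j)"
        by (rule mult_right_mono) simp
      moreover have "A \<noteq> 0" "B \<noteq> 0" using A B by auto
      ultimately show ?thesis using 2
        by (simp add: sg_def u_def norm_mult norm_power_int power_int_divide_distrib
          power_int_minus field_simps)
    next
      case 3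
      then have "complex_of_int (sg j + sg i) = 0" by (simp only: of_int_0)
      then show ?thesis using u0 q by (simp del: of_int_add)
    qed
    then show "norm (case z of (i, j) \<Rightarrow> of_int (sg j + sg i) / 2 * q powi (i * j) * A powi i *
      B powi j)
        \<le> 1 / norm q * (case z of (i, j) \<Rightarrow> u A i * u B j)" by (simp add: z)
  qed auto
  then show ?thesis by (simp only: summable_on_iff_abs_summable_on_complex)
qed

text \<open>Shifting i by N and j by M moves the thresholds to 0; the bilinear exponent turns A into
  q^M A and B into q^N B, up to the constant \<open>C\<close>.\<close>

lemma reciprocal_theta_summable:
  fixes q A B :: complex
  assumes q: "0 < norm q" and A: "norm q < norm (q powi M * A)" "norm (q powi M * A) < 1"
    and B: "norm q < norm (q powi N * B)" "norm (q powi N * B) < 1"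
  shows "(\<lambda>(i, j). of_int (sg (j - M) + sg (i - N)) / 2 * q powi (i * j) * A powi i *
    B powi j) summable_on UNIV"
proof -
  have nz: "q \<noteq> 0" "A \<noteq> 0" "B \<noteq> 0" using q A B by auto
  define C where "C = q powi (N * M) * A powi N * B powi M"
  have "(\<lambda>z. C * (case z of (i, j) \<Rightarrow> of_int (sg j + sg i) / 2 * q powi (i * j) * (q powi M *
    A) powi i * (q powi N * B) powi j)) summable_on UNIV"
    by (rule summable_on_cmult_right[OF reciprocal_theta_summable_annulus[OF q A B]])
  also have "?this \<longleftrightarrow> ?thesis"
  proof (rule summable_on_reindex_bij_witness[of _ "\<lambda>(i, j). (i - N, j - M)" "\<lambda>(i, j). (i + N, j +
    M)"])
    fix z :: "int \<times> int"
    obtain i j where z: "z = (i, j)" by (cases z)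
    have "q powi ((i + N) * (j + M)) = q powi (i * j) * q powi (M * i) * q powi (N * j) *
      q powi (N * M)"
      using nz by (simp add: algebra_simps flip: power_int_add)
    then show "(case case z of (i, j) \<Rightarrow> (i + N, j + M) of (i, j) \<Rightarrow> of_int (sg (j - M) +
      sg (i - N)) / 2 * q powi (i * j) * A powi i * B powi j)
        = C * (case z of (i, j) \<Rightarrow> of_int (sg j + sg i) / 2 * q powi (i * j) * (q powi M *
          A) powi i * (q powi N * B) powi j)"
      using nz by (simp add: z C_def power_int_add power_int_mult_distrib power_int_mult mult_ac)
  qed auto
  finally show ?thesis .
qed

text \<open>M is the first exponent at which the norm is below 1, so at M - 1 it is still above
  1.\<close>

lemma threshold_annulus:
  fixes q z :: complex
  assumes "0 < norm q" "\<And>k. nsg (q powi k * z) = sg (k - M)" "\<And>k::int. norm (q powi k * z) \<noteq> 1"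
  shows "norm q < norm (q powi M * z)" "norm (q powi M * z) < 1"
proof -
  show "norm (q powi M * z) < 1"
    using assms(2)[of M] by (auto simp: nsg_def sg_def split: if_splits)
  have "norm (q powi (M - 1) * z) > 1"
    using assms(2)[of "M - 1"] assms(3)[of "M - 1"] by (auto simp: nsg_def sg_def split: if_splits)
  moreover have "q powi M = q powi (M - 1) * q"
    using assms(1) power_int_add_1[of q "M - 1"] by auto
  ultimately show "norm q < norm (q powi M * z)"
    using assms(1) by (simp add: norm_mult)
qed

text \<open>
  The coefficient of \<open>A\<^sup>a B\<^sup>b\<close> in \<open>j(A) j(B)\<close> times the double series of \<open>kronecker_theta\<close>:
  the sum over \<open>l\<close> is finite, and for \<open>a \<noteq> b\<close> it is geometric, which leaves two vanishing theta series in \<open>w\<close>.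
\<close>

lemma kronecker_coefficient:
  fixes q :: complex
  assumes q: "0 < norm q" "norm q < 1"
    and F: "(\<lambda>(w, l). (-1) powi w * q powi (binom2 w + a * b - b * w) *
        (of_int (sg (b - M - l) + sg (l - (N + w - a))) / 2 *
          (q powi (b - a)) powi l)) summable_on UNIV"
  shows "((\<lambda>(w, l). (-1) powi w * q powi (binom2 w + a * b - b * w) *
        (of_int (sg (b - M - l) + sg (l - (N + w - a))) / 2 * (q powi (b - a)) powi l)) has_sum
      (if a = b then (-1) powi a * q powi binom2 a * qpoch_inf q q ^ 3 else 0)) UNIV"
    (is "(?F has_sum ?V) UNIV")
proof -
  define T where "T = infsum ?F UNIV"
  have T: "(?F has_sum T) (UNIV \<times> UNIV)"
    using F by (simp add: T_def)
  have q0: "q \<noteq> 0" using q by auto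
  have "T = ?V"
  proof (cases "a = b")
    case True
    \<comment> \<open>On the diagonal the ratio is 1 and the sum over l only counts, which gives a
      function linear in w. Its constant part meets a vanishing theta series, and its linear part is
      Jacobi's series for the cube; hence the factor (q;q)^3.\<close>
    have inner: "((\<lambda>l. ?F (w, l)) has_sum (-1) powi w * q powi (binom2 w + a * b - b * w) *
      of_int (b - M - (N + w - a) + 1)) UNIV" for w
      using has_sum_cmult_right[OF signed_count_sum[of "b - M" "N + w - a"]] True by simp
    have 1: "((\<lambda>w. (-1) powi w * q powi (binom2 w + a * b - b * w) * of_int (b - M - (N + w - a) +
      1)) has_sum T) UNIV"
      by (rule has_sum_SigmaD[OF T]) (rule inner)
    have "((\<lambda>w. ((-1) powi a * q powi binom2 a) * (of_int (a + 1 - M - N) * ((-1) powi w *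
      q powi (binom2 w + 0 * w)) +
        (-1) * (of_int w * (-1) powi w * q powi binom2 w))) has_sum
        ((-1) powi a * q powi binom2 a) * (of_int (a + 1 - M - N) * 0 + (-1) *
          (- (qpoch_inf q q ^ 3)))) UNIV"
      by (intro has_sum_cmult_right has_sum_add theta_series_vanishes jacobi_cube q)
    also have "?this \<longleftrightarrow> ((\<lambda>w. (-1) powi w * q powi (binom2 w + a * b - b * w) *
      of_int (b - M - (N + w - a) + 1)) has_sum ?V) UNIV"
    proof (rule has_sum_reindex_bij_witness[of _ "\<lambda>w. w - a" "\<lambda>w. w + a"])
      fix w
      have "binom2 (w + a) + a * b - b * (w + a) = binom2 a + binom2 w"
        using True by (simp add: binom2_add algebra_simps)
      then show "(-1) powi (w + a) * q powi (binom2 (w + a) + a * b - b * (w + a)) *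
        of_int (b - M - (N + (w + a) - a) + 1) =
          ((-1) powi a * q powi binom2 a) * (of_int (a + 1 - M - N) * ((-1) powi w *
            q powi (binom2 w + 0 * w)) +
          (-1) * (of_int w * (-1) powi w * q powi binom2 w))"
        using True q0 by (simp add: power_int_add) (simp add: algebra_simps)
    qed (use True in auto)
    finally show ?thesis using 1 has_sum_unique by blast
  next
    case False
    define t where "t = q powi (b - a)"
    have t: "t \<noteq> 0" using q0 by (simp add: t_def)
    have t1: "t \<noteq> 1"
    proof
      assume "t = 1"
      then have "norm q powi (b - a) = 1" by (metis norm_one norm_power_int t_def)
      then show False using False q
        power_int_strict_decreasing[of 0 "b - a" "norm q"] power_int_strict_decreasing[of "b - a"
          0 "norm q"]
        by (cases "b > a") auto
    qed
    have inner: "((\<lambda>l. ?F (w, l)) has_sum (-1) powi w * q powi (binom2 w + a * b - b * w) *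
      ((t powi (N + w - a) - t powi (b - M + 1)) / (1 - t))) UNIV" for w
      using has_sum_cmult_right[OF signed_geometric_sum[OF t t1, of "b - M" "N + w - a"]]
        by (simp add: t_def)
    have 1: "((\<lambda>w. (-1) powi w * q powi (binom2 w + a * b - b * w) * ((t powi (N +
      w - a) - t powi (b - M + 1)) / (1 - t))) has_sum T) UNIV"
      by (rule has_sum_SigmaD[OF T]) (rule inner)
    \<comment> \<open>The two endpoints of the geometric sum yield theta series with m = -a and m =
      -b: the first endpoint depends on w, and its factor t^w turns -b into -a.\<close>
    have "((\<lambda>w. (q powi (a * b) * t powi (N - a) / (1 - t)) * ((-1) powi w * q powi (binom2 w +
      (- a) * w)) +
        (- (q powi (a * b)) * t powi (b - M + 1) / (1 - t)) * ((-1) powi w * q powi (binom2 w +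
          (- b) * w))) has_sum
        (q powi (a * b) * t powi (N - a) / (1 - t)) * 0 + (- (q powi (a * b)) * t powi (b - M +
          1) / (1 - t)) * 0) UNIV"
      by (intro has_sum_cmult_right has_sum_add theta_series_vanishes q)
    moreover have "(q powi (a * b) * t powi (N - a) / (1 - t)) * ((-1) powi w * q powi (binom2 w +
      (- a) * w)) +
        (- (q powi (a * b)) * t powi (b - M + 1) / (1 - t)) * ((-1) powi w * q powi (binom2 w +
          (- b) * w)) =
        (-1) powi w * q powi (binom2 w + a * b - b * w) * ((t powi (N + w - a) - t powi (b - M +
          1)) / (1 - t))" for w
    proof -
      have "N + w - a = (N - a) + w" by simp
      then have "t powi (N + w - a) = t powi (N - a) * t powi w" using t by (metis power_int_add)
      moreover have "q powi (binom2 w + (- a) * w) = q powi (binom2 w + (- b) * w) * t powi w"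
        using q0 unfolding t_def power_int_mult[symmetric]
          by (simp add: algebra_simps flip: power_int_add)
      moreover have "q powi (binom2 w + a * b - b * w) =
        q powi (a * b) * q powi (binom2 w + (- b) * w)"
        using q0 by (simp add: algebra_simps flip: power_int_add)
      ultimately show ?thesis by (simp add: algebra_simps diff_divide_distrib)
    qed
    ultimately show ?thesis using 1 has_sum_unique False by simp
  qed
  then show ?thesis using T by simp
qed

text \<open>Both theta functions are multiplied out against the series and the coefficients of A^a
  B^b are compared. Only the diagonal a = b survives, and it is the theta series of AB.\<close>

lemma kronecker_theta:
  fixes q A B :: complex
  assumes q: "0 < norm q" "norm q < 1" and nz: "A \<noteq> 0" "B \<noteq> 0"
    and A: "\<And>k::int. norm (q powi k * A) \<noteq> 1" and B: "\<And>k::int. norm (q powi k * B) \<noteq> 1"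
  obtains G where "((\<lambda>(i, j). of_int (nsg (q powi j * A) + nsg (q powi i * B)) / 2 *
      q powi (i * j) * A powi i * B powi j) has_sum G) UNIV"
    "jtheta A q * jtheta B q * G = qpoch_inf q q ^ 3 * jtheta (A * B) q"
proof -
  have q0: "q \<noteq> 0" using q by auto
  obtain M where M: "\<And>k. nsg (q powi k * A) = sg (k - M)" using nsg_threshold[OF q nz(1) A] by blast
  obtain N where N: "\<And>k. nsg (q powi k * B) = sg (k - N)" using nsg_threshold[OF q nz(2) B] by blast
  define F where "F = (\<lambda>(i, j). of_int (sg (j - M) + sg (i - N)) / 2 * q powi (i * j) * A powi i *
    B powi j)"
  have "F summable_on UNIV"
    unfolding F_def
    by (rule reciprocal_theta_summable[OF q(1) threshold_annulus[OF q(1) M A] threshold_annulus[OF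
      q(1) N B]])
  then obtain G where G: "(F has_sum G) UNIV" by (auto simp: summable_on_def)
  define ta where "ta x k = (-1) powi k * q powi binom2 k * x powi k" for x :: complex and k :: int
  have ta: "(ta x has_sum jtheta x q) UNIV" if "x \<noteq> 0" for x
    unfolding ta_def by (rule jacobi_triple_product[OF q that])
  define W where "W = (\<lambda>(a, b) (w, l). (-1) powi w * q powi (binom2 w + a * b - b * w) *
        (of_int (sg (b - M - l) + sg (l - (N + w - a))) / 2 * (q powi (b - a)) powi l))"
  define V where "V = (\<lambda>(a::int, b). if a = b then (-1) powi a * q powi binom2 a *
    qpoch_inf q q ^ 3 else 0)"
  define S where "S = jtheta A q * jtheta B q * G"
  have "((\<lambda>(u, v). (case u of (k, l) \<Rightarrow> ta A k * ta B l) * F v) has_sum S) ((UNIV \<times> UNIV) \<times> UNIV)"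
    unfolding S_def by (intro has_sum_times_complex ta nz G)
  also have "?this \<longleftrightarrow> ((\<lambda>(u, v). (case u of (a, b) \<Rightarrow> A powi a * B powi b) * W u v) has_sum
    S) (UNIV \<times> UNIV)"
  \<comment> \<open>Here a = i + k and b = j + l are the total exponents of A and B. Keeping w = k +
    l and l as the inner indices cancels the quadratic terms in l, so that l enters only through
    q^((b-a) l).\<close>
  proof (rule has_sum_reindex_bij_witness[of _ "\<lambda>((a, b), (w, l)). ((w - l, l), (a - w + l, b - l))"
        "\<lambda>((k, l), (i, j)). ((i + k, j + l), (k + l, l))"])
    fix z :: "(int \<times> int) \<times> (int \<times> int)"
    obtain k l i j where z: "z = ((k, l), (i, j))" by (metis surj_pair)
    have e: "binom2 (k + l) + (i + k) * (j + l) - (j + l) * (k + l) + (j + l - (i + k)) * l =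
      binom2 k + binom2 l + i * j"
    proof -
      have "2 * (binom2 (k + l) + (i + k) * (j + l) - (j + l) * (k + l) + (j + l - (i + k)) * l) =
        2 * (binom2 k + binom2 l + i * j)"
        unfolding distrib_left right_diff_distrib two_binom2 by (simp add: algebra_simps)
      then show ?thesis by simp
    qed
    have "q powi (binom2 (k + l) + (i + k) * (j + l) - (j + l) * (k + l)) * (q powi (j + l - (i +
      k))) powi l =
        q powi binom2 k * q powi binom2 l * q powi (i * j)"
      using q0 unfolding power_int_mult[symmetric] by (simp add: e flip: power_int_add)
    then have "(-1) powi k * (-1) powi l * A powi i * A powi k * B powi j * B powi l * X *
        (q powi (binom2 (k + l) + (i + k) * (j + l) - (j + l) * (k + l)) * (q powi (j + l - (i +
          k))) powi l) =
        (-1) powi k * (-1) powi l * A powi i * A powi k * B powi j * B powi l * X *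
        (q powi binom2 k * q powi binom2 l * q powi (i * j))" for X by simp
    from this[of "of_int (sg (j - M) + sg (i - N)) / 2"]
    have "A powi (i + k) * B powi (j + l) * ((-1) powi (k + l) * q powi (binom2 (k + l) + (i +
      k) * (j + l) - (j + l) * (k + l)) *
        (of_int (sg (j - M) + sg (i - N)) / 2 * (q powi (j + l - (i + k))) powi l)) =
        ta A k * ta B l * (of_int (sg (j - M) + sg (i - N)) / 2 * q powi (i * j) * A powi i *
          B powi j)"
      using nz by (simp only: power_int_add ta_def mult_ac) (simp add: power_int_add mult_ac)
    then show "(case (\<lambda>((k, l), (i, j)). ((i + k, j + l), (k + l, l))) z of
          (u, v) \<Rightarrow> (case u of (a, b) \<Rightarrow> A powi a * B powi b) * W u v) =
        (case z of (u, v) \<Rightarrow> (case u of (k, l) \<Rightarrow> ta A k * ta B l) * F v)"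
      by (simp add: z W_def F_def algebra_simps del: of_int_add)
  qed auto
  finally have *: "((\<lambda>(u, v). (case u of (a, b) \<Rightarrow> A powi a * B powi b) * W u v) has_sum
    S) (UNIV \<times> UNIV)" .
  have "((\<lambda>v. (case u of (a, b) \<Rightarrow> A powi a * B powi b) * W u v) has_sum
    (case u of (a, b) \<Rightarrow> A powi a * B powi b) * V u) UNIV" for u
  proof -
    obtain a b where u: "u = (a, b)" by (cases u)
    have "(\<lambda>v. (A powi a * B powi b) * W u v) summable_on UNIV"
      using summable_on_SigmaD1[of "\<lambda>u v. (case u of (a, b) \<Rightarrow> A powi a * B powi b) *
        W u v" UNIV "\<lambda>_. UNIV" u] *
      by (auto simp: summable_on_def u)
    then have "W u summable_on UNIV"
      using nz by (subst (asm) summable_on_cmult_right') auto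
    then have "(W u has_sum V u) UNIV"
      unfolding u W_def V_def split by (rule kronecker_coefficient[OF q])
    then show ?thesis by (rule has_sum_cmult_right)
  qed
  then have "((\<lambda>u. (case u of (a, b) \<Rightarrow> A powi a * B powi b) * V u) has_sum S) UNIV"
    using has_sum_SigmaD[OF *] by simp
  also have "?this \<longleftrightarrow> ((\<lambda>u. (case u of (a, b) \<Rightarrow> A powi a * B powi b) * V u) has_sum
    S) ((\<lambda>a. (a, a)) ` UNIV)"
    by (rule has_sum_cong_neutral) (auto simp: V_def split: if_splits)
  also have "\<dots> \<longleftrightarrow> ((\<lambda>a. qpoch_inf q q ^ 3 * ta (A * B) a) has_sum S) UNIV"
    by (subst has_sum_reindex) (auto simp: inj_on_def o_def V_def ta_def power_int_mult_distrib
      mult_ac)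
  finally have "S = qpoch_inf q q ^ 3 * jtheta (A * B) q"
    by (rule has_sum_unique) (intro has_sum_cmult_right ta, use nz in simp)
  moreover have "((\<lambda>(i, j). of_int (nsg (q powi j * A) + nsg (q powi i * B)) / 2 *
      q powi (i * j) * A powi i * B powi j) has_sum G) UNIV"
    using G by (simp add: F_def M N)
  ultimately show thesis using that[of G] by (simp add: S_def)
qed

section \<open>Expansion of the Appell-Lerch sum\<close>

lemma has_sum_int_of_nat:
  fixes f :: "nat \<Rightarrow> complex"
  assumes f: "summable (\<lambda>n. norm (f n))" "f sums S" and h: "inj h"
    and g: "\<And>n. g (h n) = f n" "\<And>k::int. k \<notin> range h \<Longrightarrow> g k = 0"
  shows "(g has_sum S) UNIV"
proof -
  have "(f has_sum S) UNIV" by (rule norm_summable_imp_has_sum[OF f])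
  then have "(g has_sum S) (range h)"
    by (subst has_sum_reindex[OF h]) (simp add: o_def g(1))
  also have "?this \<longleftrightarrow> ?thesis"
    by (rule has_sum_cong_neutral) (auto simp: g(2))
  finally show ?thesis .
qed

text \<open>One formula for both expansions: the weights are 1 on l \<ge> 0 when |w| < 1, and -1 on
  l < 0 when |w| > 1.\<close>

lemma bilateral_geometric:
  fixes w :: complex
  assumes "w \<noteq> 0" "norm w \<noteq> 1"
  shows "((\<lambda>l. of_int (sg l + nsg w) / 2 * w powi l) has_sum 1 / (1 - w)) UNIV"
proof (cases "norm w < 1")
  case True
  show ?thesis
  proof (rule has_sum_int_of_nat[where h = int])
    show "summable (\<lambda>n. norm (w ^ n))" "(\<lambda>n. w ^ n) sums (1 / (1 - w))"
      using True by (auto simp: norm_power summable_geometric geometric_sums)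
    fix k :: int assume "k \<notin> range int"
    then have "k < 0" by (metis nonneg_int_cases not_less rangeI)
    then show "of_int (sg k + nsg w) / 2 * w powi k = 0" using True by (simp add: sg_def nsg_def)
  qed (use True in \<open>auto simp: sg_def nsg_def\<close>)
next
  case False
  then have w: "norm w > 1" using assms by simp
  then have n1: "norm (1 / w) < 1" by (simp add: norm_divide divide_less_eq_1)
  show ?thesis
  proof (rule has_sum_int_of_nat[where h = "\<lambda>n. - int n - 1" and f = "\<lambda>n. - (1 / w) * (1 / w) ^ n"])
    show "summable (\<lambda>n. norm (- (1 / w) * (1 / w) ^ n))"
      unfolding norm_mult norm_power using n1 by (intro summable_mult summable_geometric) simp
    have "(\<lambda>n. - (1 / w) * (1 / w) ^ n) sums (- (1 / w) * (1 / (1 - 1 / w)))"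
      by (intro sums_mult geometric_sums n1)
    also have "- (1 / w) * (1 / (1 - 1 / w)) = 1 / (1 - w)"
      using assms w by (auto simp: divide_simps)
    finally show "(\<lambda>n. - (1 / w) * (1 / w) ^ n) sums (1 / (1 - w))" .
    show "of_int (sg (- int n - 1) + nsg w) / 2 * w powi (- int n - 1) =
      - (1 / w) * (1 / w) ^ n" for n
      using assms w by (simp add: sg_def nsg_def power_int_diff power_int_minus power_one_over
        field_simps)
    fix k :: int assume "k \<notin> range (\<lambda>n. - int n - 1)"
    then have "k \<noteq> - int (nat (- k - 1)) - 1" by blast
    then have "k \<ge> 0" by (cases "k \<ge> 0") auto
    then show "of_int (sg k + nsg w) / 2 * w powi k = 0" using w by (simp add: sg_def nsg_def)
  qed (auto simp: inj_on_def)
qed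

text \<open>The previous lemma at the real point |w|, which has the same sign; multiplication by
  \<open>nsg w\<close> makes every term nonnegative.\<close>

lemma bilateral_geometric_norm:
  fixes w :: complex
  assumes "w \<noteq> 0" "norm w \<noteq> 1"
  shows "((\<lambda>l. norm (of_int (sg l + nsg w) / 2 * w powi l)) has_sum 1 / \<bar>1 - norm w\<bar>) UNIV"
proof -
  define v where "v = complex_of_real (norm w)"
  have v: "v \<noteq> 0" "norm v \<noteq> 1" "nsg v = nsg w" using assms by (auto simp: v_def nsg_def)
  have "((\<lambda>l. Re (of_int (nsg w) * (of_int (sg l + nsg v) / 2 * v powi l))) has_sum
    Re (of_int (nsg w) * (1 / (1 - v)))) UNIV"
    by (intro has_sum_Re has_sum_cmult_right bilateral_geometric v)
  moreover have "Re (of_int (nsg w) * (of_int (sg l + nsg v) / 2 * v powi l)) =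
    norm (of_int (sg l + nsg w) / 2 * w powi l)" for l
  proof -
    have "v powi l = complex_of_real (norm w powi l)" by (simp add: v_def)
    then show ?thesis
      unfolding v(3)
      by (cases "l \<ge> 0"; cases "norm w < 1")
        (auto simp: nsg_def sg_def norm_mult norm_power_int simp del: of_real_power_int)
  qed
  moreover have "Re (of_int (nsg w) * (1 / (1 - v))) = 1 / \<bar>1 - norm w\<bar>"
  proof -
    have "1 / (1 - v) = complex_of_real (1 / (1 - norm w))" by (simp add: v_def)
    then show ?thesis using assms(2) by (auto simp: nsg_def abs_if field_simps)
  qed
  ultimately show ?thesis by simp
qed

text \<open>The norms in row k add up to |q^binom(k,2)| / |1 - |q^(k-1) z||, so absolute convergence
  needs the distance of the norms from 1, not of the numbers themselves. Hence
  \<open>pole_distance\<close> is applied to |q| and |z|.\<close>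

lemma lerch_series_expansion:
  fixes q z :: complex
  assumes q: "0 < norm q" "norm q < 1" and z: "z \<noteq> 0" "\<And>k::int. norm (q powi k * z) \<noteq> 1"
  shows "((\<lambda>(k, l). q powi binom2 k * (of_int (sg l + nsg (q powi (k - 1) * z)) / 2 *
    (q powi (k - 1) * z) powi l))
    has_sum (\<Sum>\<^sub>\<infinity>k. q powi binom2 k / (1 - q powi (k - 1) * z))) UNIV" (is "(?F has_sum ?S) UNIV")
proof -
  have q0: "q \<noteq> 0" using q by auto
  have "complex_of_real (norm q) powi k * complex_of_real (norm z) \<noteq> 1" for k
  proof
    assume "complex_of_real (norm q) powi k * complex_of_real (norm z) = 1"
    then have "complex_of_real (norm q powi k * norm z) = complex_of_real 1" by simp
    then have "norm q powi k * norm z = 1" by (simp only: of_real_eq_iff)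
    then show False using z(2)[of k] by (simp add: norm_mult norm_power_int)
  qed
  then obtain c where c: "c > 0" "\<And>k. norm (1 - complex_of_real (norm q) powi k *
    complex_of_real (norm z)) \<ge> c * (1 + norm q powi k)"
    using pole_distance[of "complex_of_real (norm q)" "complex_of_real (norm z)"] q z(1)
      by (auto simp del: of_real_power_int)
  have c': "\<bar>1 - norm (q powi k * z)\<bar> \<ge> c" for k
  proof -
    have "1 - complex_of_real (norm q) powi k * complex_of_real (norm z) =
      complex_of_real (1 - norm (q powi k * z))"
      by (simp add: norm_mult norm_power_int)
    then have "\<bar>1 - norm (q powi k * z)\<bar> \<ge> c * (1 + norm q powi k)"
      using c(2)[of k] by (simp only: norm_of_real)
    moreover have "c * (1 + norm q powi k) \<ge> c * 1" using c(1) by (intro mult_left_mono) auto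
    ultimately show ?thesis by linarith
  qed
  have nw: "q powi (k - 1) * z \<noteq> 0" for k using q0 z by simp
  have inner: "((\<lambda>l. ?F (k, l)) has_sum q powi binom2 k / (1 - q powi (k - 1) * z)) UNIV" for k
    using has_sum_cmult_right[OF bilateral_geometric[OF nw[of k] z(2)[of "k - 1"]],
      of "q powi binom2 k"] by simp
  have innern: "((\<lambda>l. norm (?F (k, l))) has_sum
    norm (q powi binom2 k) * (1 / \<bar>1 - norm (q powi (k - 1) * z)\<bar>)) UNIV" for k
    using has_sum_cmult_right[OF bilateral_geometric_norm[OF nw[of k] z(2)[of "k - 1"]],
      of "norm (q powi binom2 k)"]
    by (simp only: norm_mult split)
  have sq: "(\<lambda>k. norm q powi binom2 k * 1 powi k * (1 / c)) summable_on UNIV"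
    using q by (intro summable_on_cmult_left theta_series_summable_real) auto
  have bd: "norm q powi binom2 k * (1 / \<bar>1 - norm (q powi (k - 1) * z)\<bar>) \<le>
    norm q powi binom2 k * 1 powi k * (1 / c)" for k
    using c' c(1) q by (simp only: power_int_1_left mult_1_right, intro mult_left_mono frac_le) auto
  have "(\<lambda>v. norm (?F v)) summable_on UNIV \<times> UNIV"
  proof (rule summable_on_SigmaI[OF innern])
    show "(\<lambda>k. norm (q powi binom2 k) * (1 / \<bar>1 - norm (q powi (k - 1) * z)\<bar>)) summable_on UNIV"
      by (rule summable_on_comparison_test[OF sq]) (use bd in \<open>auto simp: norm_power_int\<close>)
  qed auto
  then have F: "?F summable_on UNIV \<times> UNIV" by (simp only: summable_on_iff_abs_summable_on_complex)
  have "((\<lambda>k. q powi binom2 k / (1 - q powi (k - 1) * z)) has_sum infsum ?F (UNIV \<times> UNIV)) UNIV"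
    by (rule has_sum_SigmaD[OF has_sum_infsum[OF F]]) (rule inner)
  then have "?S = infsum ?F (UNIV \<times> UNIV)" by (rule infsumI)
  then show ?thesis using has_sum_infsum[OF F] by simp
qed

lemma jtheta_minus_1:
  fixes q :: complex
  assumes "0 < norm q" "norm q < 1"
  shows "((\<lambda>k. q powi binom2 k) has_sum jtheta (-1) q) UNIV" "jtheta (-1) q \<noteq> 0"
proof -
  show "((\<lambda>k. q powi binom2 k) has_sum jtheta (-1) q) UNIV"
    using jacobi_triple_product[OF assms, of "-1"]
    by (simp add: mult.commute[of _ "q powi _"] mult.assoc power_int_minus_one_mult_self')
  have "q ^ i * (- 1) \<noteq> 1" for i
  proof (cases "i = 0")
    case False
    then have "norm (q ^ i * (- 1)) < 1" using assms by (simp add: norm_power power_less_one_iff)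
    then show ?thesis by (metis less_irrefl norm_one)
  qed auto
  moreover have "q ^ i * (q / - 1) \<noteq> 1" for i
  proof -
    have "norm (q ^ i * (q / - 1)) = norm q ^ Suc i" by (simp add: norm_mult norm_power)
    also have "\<dots> < 1" using assms by (intro power_Suc_less_one) auto
    finally show ?thesis by (metis less_irrefl norm_one)
  qed
  ultimately show "jtheta (-1) q \<noteq> 0"
    using qpoch_self_nonzero[OF assms(2)] by (simp add: jtheta_def qpoch_nonzero[OF assms(2)])
qed

text \<open>The first argument is - z because the denominators multiply it by the third argument
  -1.\<close>

lemma appell_lerch_minus_1:
  fixes q z :: complex
  assumes "0 < norm q" "norm q < 1"
  shows "appell_lerch (- z) q (-1) * jtheta (-1) q =
    (\<Sum>\<^sub>\<infinity>k. q powi binom2 k / (1 - q powi (k - 1) * z))"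
proof -
  have e: "(-1) powi k * q powi binom2 k * (-1) powi k = q powi binom2 k" for k :: int
    by (simp add: mult.commute[of _ "q powi _"] mult.assoc power_int_minus_one_mult_self')
  show ?thesis
    unfolding appell_lerch_def e using jtheta_minus_1(2)[OF assms] by simp
qed

section \<open>Triple series for the Hecke-type sum and for g\<close>

text \<open>The unsigned summand of f, with (-1)^(r+s) absorbed into the powers of -x and -y, times
  the k-th term of the series for j(-1; Q), where Q = q^(n(b^2 - n^2)).\<close>

definition hecke_term :: "int \<Rightarrow> int \<Rightarrow> complex \<Rightarrow> complex \<Rightarrow> complex \<Rightarrow> int \<times> int \<times> int \<Rightarrow> complex" where
  "hecke_term n b x y q = (\<lambda>(r, s, k). (- x) powi r * (- y) powi s *
     q powi (n * binom2 r + b * r * s + n * binom2 s + n * (b\<^sup>2 - n * n) * binom2 k))"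

lemma norm_powi_less_1:
  fixes q :: complex
  assumes "0 < norm q" "norm q < 1" "m > 0"
  shows "0 < norm (q powi m)" "norm (q powi m) < 1"
  using assms power_int_strict_decreasing[of 0 m "norm q"] by (auto simp: norm_power_int)

text \<open>The weight extends the sum to the full lattice. Where it is nonzero, b r s \<ge> 0, so
  the cross factor is at most 1 in norm and a product of two theta series dominates.\<close>

lemma hecke_f_has_sum:
  fixes q x y :: complex
  assumes q: "0 < norm q" "norm q < 1" and n: "n > 0" and b: "b > 0" and nz: "x \<noteq> 0" "y \<noteq> 0"
  shows "((\<lambda>(r, s). of_int (sg r + sg s) / 2 * ((- x) powi r * (- y) powi s *
     q powi (n * binom2 r + b * r * s + n * binom2 s))) has_sum hecke_f n b n x y q) UNIV"
    (is "(?F has_sum _) UNIV")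
proof -
  define u where "u c r = norm (q powi n) powi binom2 r *
    norm c powi r" for c :: complex and r :: int
  have u0: "u c r \<ge> 0" for c r by (simp add: u_def)
  have "u c summable_on UNIV" if "c \<noteq> 0" for c
    unfolding u_def using that norm_powi_less_1[OF q n] by (intro theta_series_summable_real) auto
  then have sm: "(\<lambda>(r, s). u x r * u y s) summable_on UNIV"
    using summable_on_times_real[of "u x" UNIV "u y" UNIV] nz u0 by simp
  have "(\<lambda>z. norm (?F z)) summable_on UNIV"
  proof (rule summable_on_comparison_test[OF sm])
    fix z :: "int \<times> int"
    obtain r s where z: "z = (r, s)" by (cases z)
    show "norm (?F z) \<le> (case z of (r, s) \<Rightarrow> u x r * u y s)"
    proof (cases "sg r + sg s = 0")
      case True
      then have "?F z = 0" unfolding z split by (simp only: of_int_0) simp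
      then have "norm (?F z) = 0" by (simp only: norm_zero)
      moreover have "0 \<le> (case z of (r, s) \<Rightarrow> u x r * u y s)" using u0 by (simp add: z)
      ultimately show ?thesis by linarith
    next
      case False
      then have "norm (complex_of_int (sg r + sg s) / 2) = 1"
        by (auto simp: sg_def split: if_splits)
      moreover have "b * r * s \<ge> 0"
        using False b by (auto simp: sg_def mult.assoc zero_le_mult_iff split: if_splits)
      then have "norm q powi (b * r * s) \<le> 1"
        using power_int_decreasing[of 0 "b * r * s" "norm q"] q by simp
      then have "norm q powi (b * r * s) * (u x r * u y s) \<le> 1 * (u x r * u y s)"
        using u0 by (intro mult_right_mono) auto
      moreover have "norm q powi (n * binom2 r + b * r * s + n * binom2 s) =
          norm q powi (b * r * s) * ((norm q powi n) powi binom2 r * (norm q powi n) powi binom2 s)"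
        using q unfolding power_int_mult[symmetric] by (simp add: power_int_add)
      ultimately show ?thesis
        unfolding z split norm_mult norm_power_int u_def norm_minus_cancel
          by (simp only: mult_ac mult_1_left)
    qed
  qed auto
  then have "(?F has_sum infsum ?F UNIV) UNIV"
    by (intro has_sum_infsum) (simp only: summable_on_iff_abs_summable_on_complex)
  moreover have "infsum ?F UNIV = hecke_f n b n x y q"
    unfolding hecke_f_def
  proof (rule infsum_cong_neutral)
    fix z :: "int \<times> int"
    obtain r s where z: "z = (r, s)" by (cases z)
    show "?F z = 0" if "z \<in> UNIV - {(r, s). sg r = sg s}"
      using that by (auto simp: z sg_def split: if_splits)
    show "?F z = (case z of (r, s) \<Rightarrow> of_int (sg r) * (-1) powi (r + s) * x powi r * y powi s *
      q powi (n * binom2 r + b * r * s + n * binom2 s))"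
      if "z \<in> UNIV \<inter> {(r, s). sg r = sg s}"
    proof -
      have "(-1 :: complex) powi (r + s) = (-1) powi r * (-1) powi s" by (simp add: power_int_add)
      moreover have "(- x) powi r = (-1) powi r * x powi r" "(- y) powi s = (-1) powi s * y powi s"
        using power_int_mult_distrib[of "-1" x r] power_int_mult_distrib[of "-1" y s] by simp_all
      moreover have "complex_of_int (sg r + sg s) / 2 = of_int (sg r)" using that by (simp add: z)
      ultimately show ?thesis unfolding z split by (simp only: mult_ac)
    qed
  qed auto
  ultimately show ?thesis by (simp only:)
qed

lemma hecke_f_triple_sum:
  fixes q x y :: complex
  assumes q: "0 < norm q" "norm q < 1" and n: "n > 0" and b: "b > n" and nz: "x \<noteq> 0" "y \<noteq> 0"
  shows "((\<lambda>(r, s, k). of_int (sg r + sg s) / 2 * hecke_term n b x y q (r, s, k)) has_sum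
    hecke_f n b n x y q * jtheta (-1) (q powi (n * (b\<^sup>2 - n * n)))) UNIV"
proof -
  have "b\<^sup>2 - n * n > 0" using n b by (simp add: power2_eq_square mult_strict_mono)
  then have Q: "0 < norm (q powi (n * (b\<^sup>2 - n * n)))" "norm (q powi (n * (b\<^sup>2 - n * n))) < 1"
    using n norm_powi_less_1[OF q, of "n * (b\<^sup>2 - n * n)"] by auto
  have b0: "b > 0" using n b by simp
  have "((\<lambda>(z, k). (case z of (r, s) \<Rightarrow> of_int (sg r + sg s) / 2 * ((- x) powi r * (- y) powi s *
     q powi (n * binom2 r + b * r * s + n * binom2 s))) * (q powi (n * (b\<^sup>2 - n *
       n))) powi binom2 k) has_sum
    hecke_f n b n x y q * jtheta (-1) (q powi (n * (b\<^sup>2 - n * n)))) (UNIV \<times> UNIV)"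
    by (intro has_sum_times_complex hecke_f_has_sum jtheta_minus_1(1) q n b0 nz Q)
  also have "?this \<longleftrightarrow> ?thesis"
  proof (rule has_sum_reindex_bij_witness[of _ "\<lambda>(r, s, k). ((r, s), k)" "\<lambda>((r, s), k). (r, s, k)"])
    fix z :: "(int \<times> int) \<times> int"
    obtain r s k where z: "z = ((r, s), k)" by (metis surj_pair)
    have "q \<noteq> 0" using q by auto
    then show "(case (\<lambda>((r, s), k). (r, s, k)) z of (r, s, k) \<Rightarrow> of_int (sg r + sg s) / 2 *
      hecke_term n b x y q (r, s, k)) =
      (case z of (z, k) \<Rightarrow> (case z of (r, s) \<Rightarrow> of_int (sg r + sg s) / 2 * ((- x) powi r *
        (- y) powi s *
        q powi (n * binom2 r + b * r * s + n * binom2 s))) * (q powi (n * (b\<^sup>2 - n *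
          n))) powi binom2 k)"
      unfolding z by (simp only: split hecke_term_def power_int_mult[symmetric]) (simp add:
        power_int_add mult_ac)
  qed auto
  finally show ?thesis .
qed

text \<open>Since the outer parameters agree (a = c = n), exchanging x and y gives the other half of
  g.\<close>

definition half_g :: "int \<Rightarrow> int \<Rightarrow> complex \<Rightarrow> complex \<Rightarrow> complex \<Rightarrow> complex" where
  "half_g n b x y q = (\<Sum>t=0..n-1. (- y) powi t * q powi (n * binom2 t) * jtheta (q powi (b * t) *
    x) (q powi n) *
        appell_lerch (g_arg n b n x y q t) (q powi (n * (b\<^sup>2 - n * n))) (-1))"

text \<open>
  The denominators in the Appell-Lerch sums of \<open>half_g n b x y q\<close> are \<open>1 - pole_arg n b x y q m\<close>,
  and the reciprocals of the same numbers are the arguments of \<open>theta_den\<close> (lemma \<open>theta_den_eq\<close>).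
\<close>

definition pole_arg :: "int \<Rightarrow> int \<Rightarrow> complex \<Rightarrow> complex \<Rightarrow> complex \<Rightarrow> int \<Rightarrow> complex" where
  "pole_arg n b x y q m = q powi (n * binom2 (b + 1) - n * binom2 (n + 1) + m * (b\<^sup>2 - n * n)) *
    ((- y) powi n / (- x) powi b)"

lemma half_g_triple_sum:
  fixes q x y :: complex
  assumes q: "0 < norm q" "norm q < 1" and n: "n > 0" and b: "b > n" and nz: "x \<noteq> 0" "y \<noteq> 0"
    and off: "\<And>m. norm (pole_arg n b x y q m) \<noteq> 1"
  shows "((\<lambda>(r, s, k). of_int (sg s + nsg (pole_arg n b x y q (n * (k - 1) - s))) / 2 *
    hecke_term n b x y q (r, s, k)) has_sum
    half_g n b x y q * jtheta (-1) (q powi (n * (b\<^sup>2 - n * n)))) UNIV"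
proof -
  define D where "D = b\<^sup>2 - n * n"
  define e where "e = n * binom2 (b + 1) - n * binom2 (n + 1)"
  define Q where "Q = q powi (n * D)"
  define z where "z t = q powi (e - t * D) * ((- y) powi n / (- x) powi b)" for t
  have q0: "q \<noteq> 0" using q by auto
  have "D > 0" using n b by (simp add: D_def power2_eq_square mult_strict_mono)
  then have Q: "0 < norm Q" "norm Q < 1"
    using n norm_powi_less_1[OF q, of "n * D"] by (auto simp: Q_def)
  have Qz: "Q powi m * z t = pole_arg n b x y q (n * m - t)" for m t
  proof -
    have "Q powi m * q powi (e - t * D) = q powi (e + (n * m - t) * D)"
      unfolding Q_def power_int_mult[symmetric] using q0
        by (simp add: algebra_simps flip: power_int_add)
    then show ?thesis by (simp add: z_def pole_arg_def D_def[symmetric] e_def[symmetric] flip: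
      mult.assoc)
  qed
  have z0: "z t \<noteq> 0" for t using q0 nz by (simp add: z_def)
  have ga: "g_arg n b n x y q t = - z t" for t by (simp add: g_arg_def z_def e_def D_def)
  define th where "th t i = (-1) powi i * (q powi n) powi binom2 i * (q powi (b * t) *
    x) powi i" for t i
  define L where "L t = (\<lambda>(k, l). Q powi binom2 k * (of_int (sg l + nsg (Q powi (k - 1) *
    z t)) / 2 * (Q powi (k - 1) * z t) powi l))" for t
  define c where "c t = (- y) powi t * q powi (n * binom2 t)" for t
  have summand: "((\<lambda>v. c t * (case v of (i, w) \<Rightarrow> th t i * L t w)) has_sum
      c t * (jtheta (q powi (b * t) * x) (q powi n) * (appell_lerch (g_arg n b n x y q t) Q (-1) *
        jtheta (-1) Q))) (UNIV \<times> UNIV)" for t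
    unfolding ga appell_lerch_minus_1[OF Q] th_def L_def using q0 nz off
    by (intro has_sum_cmult_right has_sum_times_complex jacobi_triple_product norm_powi_less_1 q n
      lerch_series_expansion Q z0) (auto simp: Qz)
  have "((\<lambda>(t, v). c t * (case v of (i, w) \<Rightarrow> th t i * L t w)) has_sum
      (\<Sum>t\<in>{0..n-1}. c t * (jtheta (q powi (b * t) * x) (q powi n) *
        (appell_lerch (g_arg n b n x y q t) Q (-1) * jtheta (-1) Q)))) ({0..n-1} \<times> (UNIV \<times> UNIV))"
    by (intro has_sum_finite_Sigma summand) auto
  also have "(\<Sum>t\<in>{0..n-1}. c t * (jtheta (q powi (b * t) * x) (q powi n) *
    (appell_lerch (g_arg n b n x y q t) Q (-1) * jtheta (-1) Q))) =
      half_g n b x y q * jtheta (-1) Q"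
    unfolding half_g_def sum_distrib_right by (intro sum.cong) (simp_all add: c_def Q_def D_def
      mult_ac)
  also have "((\<lambda>(t, v). c t * (case v of (i, w) \<Rightarrow> th t i * L t w)) has_sum
    half_g n b x y q * jtheta (-1) Q) ({0..n-1} \<times> (UNIV \<times> UNIV)) \<longleftrightarrow>
    ((\<lambda>(r, s, k). of_int (sg s + nsg (pole_arg n b x y q (n * (k - 1) - s))) / 2 *
      hecke_term n b x y q (r, s, k)) has_sum half_g n b x y q * jtheta (-1) Q) UNIV"
  \<comment> \<open>Division with remainder s = t + n l joins the finite index t of g and the
    geometric exponent l. The l-th power of the Appell-Lerch argument contributes (-y)^(n l)
    (-x)^(-b l), hence r = i - b l; replacing k by k + l completes the quadratic exponent.\<close>
  proof (rule has_sum_reindex_bij_witness[of _ "\<lambda>(r, s, k). (s mod n, (r + b *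
    (s div n), (k - s div n, s div n)))"
        "\<lambda>(t, (i, (k, l))). (i - b * l, t + n * l, k + l)"])
    fix v :: "int \<times> (int \<times> (int \<times> int))"
    assume v: "v \<in> {0..n-1} \<times> (UNIV \<times> UNIV)"
    obtain t i k l where v_eq: "v = (t, (i, (k, l)))" by (metis surj_pair)
    have t: "0 \<le> t" "t < n" using v by (auto simp: v_eq)
    have div: "(t + n * l) div n = l" "(t + n * l) mod n = t"
      using t n by (simp_all add: div_pos_pos_trivial mod_pos_pos_trivial)
    then show "(\<lambda>(r, s, k). (s mod n, (r + b *
      (s div n), (k - s div n, s div n)))) ((\<lambda>(t, (i, (k, l))). (i - b * l, t + n * l, k +
        l)) v) = v"
      by (simp add: v_eq)
    \<comment> \<open>As 0 \<le> t < n, the sign of the geometric exponent is the sign of s.\<close>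
    have sgs: "sg (t + n * l) = sg l"
    proof (cases "l \<ge> 0")
      case True
      then show ?thesis using t n by (simp add: sg_def)
    next
      case False
      then have "n * l \<le> n * (-1)" using n by (intro mult_left_mono) auto
      then show ?thesis using t False by (simp add: sg_def)
    qed
    have arg: "pole_arg n b x y q (n * (k + l - 1) - (t + n * l)) = Q powi (k - 1) * z t"
      unfolding Qz by (simp add: algebra_simps)
    have h1: "th t i = (- x) powi i * q powi (n * binom2 i + b * t * i)"
    proof -
      have "(- x) powi i = (-1) powi i * x powi i" using power_int_mult_distrib[of "-1" x i] by simp
      then show ?thesis using q0 by (simp add: th_def power_int_mult_distrib power_int_add
        power_int_mult)
    qed
    have h2: "(Q powi (k - 1) * z t) powi l =
      (- x) powi (- (b * l)) * (- y) powi (n * l) * q powi ((n * D * (k - 1) + (e - t * D)) * l)"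
    proof -
      have "Q powi (k - 1) * z t = q powi (n * D * (k - 1) + (e - t * D)) *
        ((- y) powi n / (- x) powi b)"
        using q0 by (simp add: Q_def z_def power_int_add power_int_mult)
      then show ?thesis
        by (simp only: power_int_mult_distrib power_int_divide_distrib power_int_mult[symmetric]
          power_int_minus power_int_inverse divide_inverse mult_ac)
    qed
    have h3: "Q powi binom2 k = q powi (n * D * binom2 k)" by (simp add: Q_def power_int_mult)
    have ee: "n * binom2 t + (n * binom2 i + b * t * i) + n * D * binom2 k + (n * D * (k - 1) +
      (e - t * D)) * l =
        n * binom2 (i - b * l) + b * (i - b * l) * (t + n * l) + n * binom2 (t + n * l) + n * D *
          binom2 (k + l)"
    proof -
      have e2: "2 * e = n * ((b + 1) * b) - n * ((n + 1) * n)"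
        using two_binom2[of "b + 1"] two_binom2[of "n + 1"] by (simp add: e_def algebra_simps)
      have "2 * (n * binom2 t + (n * binom2 i + b * t * i) + n * D * binom2 k + (n * D * (k - 1) +
        (e - t * D)) * l) =
        n * (2 * binom2 t) + n * (2 * binom2 i) + 2 * (b * t * i) + n * D * (2 * binom2 k) +
        (2 * (n * D * (k - 1)) + 2 * e - 2 * (t * D)) * l"
        by (simp add: algebra_simps)
      also have "\<dots> = n * (2 * binom2 (i - b * l)) + 2 * (b * (i - b * l) * (t + n * l)) + n * (2 *
        binom2 (t + n * l)) + n * D * (2 * binom2 (k + l))"
        unfolding two_binom2 e2 D_def power2_eq_square by algebra
      finally show ?thesis by simp
    qed
    have "c t * (th t i * (Q powi binom2 k * (W * (Q powi (k - 1) * z t) powi l))) =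
        W * ((- x) powi (i - b * l) * (- y) powi (t + n * l) * q powi (n * binom2 (i - b * l) +
          b * (i - b * l) * (t + n * l) + n * binom2 (t + n * l) + n * D * binom2 (k + l)))" for W
    proof -
      have "(- x) powi (i - b * l) = (- x) powi i * (- x) powi (- (b * l))" using nz
        by (simp flip: power_int_add)
      moreover have "(- y) powi (t + n * l) = (- y) powi t * (- y) powi (n * l)" using nz
        by (simp flip: power_int_add)
      ultimately show ?thesis
        unfolding h1 h2 h3 c_def ee[symmetric] using q0
          by (simp only: power_int_add mult_ac) (simp add: power_int_add mult_ac)
    qed
    then show "(\<lambda>(r, s, k). of_int (sg s + nsg (pole_arg n b x y q (n * (k - 1) - s))) / 2 *
      hecke_term n b x y q (r, s, k)) ((\<lambda>(t, (i, (k, l))). (i - b * l, t + n * l, k + l)) v) =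
      (case v of (t, v) \<Rightarrow> c t * (case v of (i, w) \<Rightarrow> th t i * L t w))"
      by (simp only: v_eq split sgs arg hecke_term_def L_def D_def[symmetric])
  next
    fix v :: "int \<times> int \<times> int"
    obtain r s k where v_eq: "v = (r, s, k)" by (metis surj_pair)
    show "(\<lambda>(t, (i, (k, l))). (i - b * l, t + n * l, k + l)) ((\<lambda>(r, s, k). (s mod n, (r + b *
      (s div n), (k - s div n, s div n)))) v) = v"
      by (simp add: v_eq)
    show "(\<lambda>(r, s, k). (s mod n, (r + b * (s div n), (k - s div n,
      s div n)))) v \<in> {0..n-1} \<times> (UNIV \<times> UNIV)"
      using n pos_mod_bound[of n s] by (simp add: v_eq)
  qed auto
  finally show ?thesis by (simp add: Q_def D_def)
qed

section \<open>Triple series for the theta quotients\<close>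

lemma pole_arg_shift:
  assumes "q \<noteq> 0"
  shows "q powi (m * (b\<^sup>2 - n * n)) * inverse (pole_arg n b x y q a) =
    inverse (pole_arg n b x y q (a - m))"
proof -
  have "n * binom2 (b + 1) - n * binom2 (n + 1) + a * (b\<^sup>2 - n * n) =
      (n * binom2 (b + 1) - n * binom2 (n + 1) + (a - m) * (b\<^sup>2 - n * n)) + m * (b\<^sup>2 - n * n)"
    by (simp add: algebra_simps)
  then have "pole_arg n b x y q a = pole_arg n b x y q (a - m) * q powi (m * (b\<^sup>2 - n * n))"
    unfolding pole_arg_def using assms by (simp only: power_int_add mult_ac) (simp add: mult_ac
      power_int_add)
  then show ?thesis using assms by simp
qed

text \<open>Integral and half-integral r are treated at once: r + (n+1)/2 is the integer k + n div 2
  + 1, and 2 e = n (D + p) makes the remaining halves combine to -e.\<close>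

lemma theta_den_eq:
  fixes n p k :: int
  shows "theta_den n p x y q (half_shift n k) =
    jtheta (inverse (pole_arg n (n + p) y x q (- (k + n div 2 + 1)))) (q powi (p * ((n +
      p)\<^sup>2 - n * n)))"
proof -
  define e where "e = n * binom2 (n + p + 1) - n * binom2 (n + 1)"
  define D where "D = (n + p)\<^sup>2 - n * n"
  have D: "D = p * (2 * n + p)" by (simp add: D_def power2_eq_square algebra_simps)
  have "2 * e = n * (2 * binom2 (n + p + 1)) - n * (2 * binom2 (n + 1))"
    by (simp add: e_def algebra_simps)
  also have "\<dots> = n * (D + p)" unfolding two_binom2 D by (simp add: algebra_simps)
  finally have e2: "2 * real_of_int e = real_of_int n * (real_of_int D + real_of_int p)"
    by (metis of_int_add of_int_mult of_int_numeral)
  have h: "half_shift n k = of_int (k + n div 2 + 1) - of_int (n + 1) / 2"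
    using half_shift_plus[of n k] by simp
  have "2 * (of_int (p * (2 * n + p)) * half_shift n k + of_int (p * (n + p)) / 2) =
    2 * real_of_int (D * (k + n div 2 + 1) - e)"
    unfolding h right_diff_distrib of_int_diff e2 D by (simp add: field_simps)
  then have "of_int (p * (2 * n + p)) * half_shift n k + of_int (p * (n + p)) / 2 =
    real_of_int (D * (k + n div 2 + 1) - e)"
    by simp
  then have fl: "\<lfloor>of_int (p * (2 * n + p)) * half_shift n k + of_int (p * (n + p)) / 2\<rfloor> =
    - (e + (- (k + n div 2 + 1)) * D)"
    by (simp only: floor_of_int) (simp add: algebra_simps)
  have "p\<^sup>2 * (2 * n + p) = p * D" by (simp add: D power2_eq_square)
  then show ?thesis
    unfolding theta_den_def fl pole_arg_def D_def[symmetric] e_def[symmetric]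
    by (simp only: power_int_minus inverse_mult_distrib) (simp add: field_simps)
qed

text \<open>Removes floors and half-integers: r - (n-1)/2 and s + (n+1)/2 become r + \<nu> - n and s
  + \<nu> for integers r, s. It also exhibits the last numerator as j(A B) for the two denominator
  arguments, which is the shape required by \<open>kronecker_theta\<close>.\<close>

lemma theta_np_eq:
  fixes n p :: int
  assumes q: "0 < norm q" "norm q < 1" and np: "n > 0" "p > 0" and nz: "x \<noteq> 0" "y \<noteq> 0"
  defines "b \<equiv> n + p" and "\<nu> \<equiv> n div 2 + 1"
  defines "D \<equiv> b\<^sup>2 - n * n"
  defines "Q \<equiv> q powi (p * D)"
  defines "A \<equiv> \<lambda>r. inverse (pole_arg n b y x q (- (r + \<nu>)))"
    and "B \<equiv> \<lambda>s. inverse (pole_arg n b x y q (- (s + \<nu>)))"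
  shows "theta_np n p x y q = (\<Sum>(r, s)\<in>{0..p-1} \<times> {0..p-1}.
    ((- x) powi (r + \<nu> - n) * (- y) powi (s + \<nu>) *
      q powi (n * binom2 (r + \<nu> - n) + b * (r + \<nu> - n) * (s + \<nu>) + n * binom2 (s + \<nu>))) *
    (jtheta (- (q powi (n * p * (s - r))) * (x powi n / y powi n)) (q powi (n * p\<^sup>2)) *
     (qpoch_inf Q Q ^ 3 * jtheta (A r * B s) Q / (jtheta (A r) Q * jtheta (B s) Q))))"
  unfolding theta_np_def sum.cartesian_product[symmetric]
proof (intro sum.cong refl)
  fix r s assume rs: "r \<in> {0..p-1}" "s \<in> {0..p-1}"
  have q0: "q \<noteq> 0" using q by auto
  define e where "e = n * binom2 (b + 1) - n * binom2 (n + 1)"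
  have D: "D = p * (2 * n + p)" by (simp add: D_def b_def power2_eq_square algebra_simps)
  have e2: "2 * e = n * (D + p)"
  proof -
    have "2 * e = n * (2 * binom2 (b + 1)) - n * (2 * binom2 (n + 1))"
      by (simp add: e_def algebra_simps)
    also have "\<dots> = n * (D + p)" unfolding two_binom2 D b_def by (simp add: algebra_simps)
    finally show ?thesis .
  qed
  have nu: "n - \<nu> = (n - 1) div 2" by (simp add: \<nu>_def)
  have u: "half_shift n r - of_int (n - 1) / 2 = of_int (r + \<nu> - n)"
    using half_shift_minus[of n r] nu by (simp add: algebra_simps)
  have v: "half_shift n s + of_int (n + 1) / 2 = of_int (s + \<nu>)"
    using half_shift_plus[of n s] by (simp add: \<nu>_def algebra_simps)
  have f1: "\<lfloor>real_of_int n * (real_of_int (r + \<nu> - n) gchoose 2) + real_of_int (n + p) *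
    real_of_int (r + \<nu> - n) * real_of_int (s + \<nu>) + real_of_int n * (real_of_int (s + \<nu>) gchoose 2)\<rfloor>
      = n * binom2 (r + \<nu> - n) + b * (r + \<nu> - n) * (s + \<nu>) + n * binom2 (s + \<nu>)"
    unfolding gchoose_2_of_int of_int_mult[symmetric] of_int_add[symmetric] floor_of_int b_def ..
  have "of_int (n * p) * (half_shift n s - half_shift n r) = real_of_int (n * p * (s - r))"
    by (simp add: half_shift_def)
  then have f2: "\<lfloor>of_int (n * p) * (half_shift n s - half_shift n r)\<rfloor> = n * p * (s - r)"
    by (simp only: floor_of_int)
  have "of_int (p * (2 * n + p)) * (half_shift n r + half_shift n s) + of_int (p * (n + p)) =
      real_of_int (D * (r + \<nu> - n) + D * (s + \<nu>) + (p * (n + p) - D))"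
  proof -
    have "half_shift n r + half_shift n s = of_int (r + \<nu> - n) + of_int (s + \<nu>) - 1"
      using u v by (simp add: field_simps)
    then show ?thesis unfolding D by (simp only: of_int_add of_int_mult of_int_diff) (simp add:
      algebra_simps)
  qed
  moreover have "D * (r + \<nu> - n) + D * (s + \<nu>) + (p * (n + p) - D) =
    D * (r + \<nu>) + D * (s + \<nu>) - 2 * e"
    unfolding e2 D by (simp add: algebra_simps)
  ultimately have f3: "\<lfloor>of_int (p * (2 * n + p)) * (half_shift n r + half_shift n s) + of_int (p *
    (n + p))\<rfloor> = D * (r + \<nu>) + D * (s + \<nu>) - 2 * e"
    by (simp only: floor_of_int)
  have AB: "q powi (D * (r + \<nu>) + D * (s + \<nu>) - 2 * e) * x powi p * y powi p = A r * B s"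
  proof -
    have "A r * B s = q powi (- (e + (- (r + \<nu>)) * D)) * q powi (- (e + (- (s + \<nu>)) * D)) *
        (((- y) powi b / (- y) powi n) * ((- x) powi b / (- x) powi n))"
      unfolding A_def B_def pole_arg_def D_def[symmetric] e_def[symmetric] power_int_minus
      by (simp add: field_simps)
    also have "q powi (- (e + (- (r + \<nu>)) * D)) * q powi (- (e + (- (s + \<nu>)) * D)) =
      q powi (D * (r + \<nu>) + D * (s + \<nu>) - 2 * e)"
      using q0 by (simp add: algebra_simps flip: power_int_add)
    also have "(- y) powi b / (- y) powi n = (- y) powi p" using nz
      by (simp add: b_def power_int_add)
    also have "(- x) powi b / (- x) powi n = (- x) powi p" using nz
      by (simp add: b_def power_int_add)
    also have "(- y) powi p * (- x) powi p = x powi p * y powi p"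
      by (simp add: power_int_minus_left)
    finally show ?thesis by (simp add: mult_ac)
  qed
  have Q: "p\<^sup>2 * (2 * n + p) = p * D" by (simp add: D power2_eq_square)
  have "p * D > 0" using np by (simp add: D)
  then have J: "J1 (p * D) q = qpoch_inf Q Q" using J1_eq_qpoch[OF q] by (simp add: Q_def)
  have dA: "theta_den n p x y q (half_shift n r) = jtheta (A r) Q"
    by (simp add: theta_den_eq A_def Q_def D_def b_def \<nu>_def add.assoc)
  have dB: "theta_den n p y x q (half_shift n s) = jtheta (B s) Q"
    by (simp add: theta_den_eq B_def Q_def D_def b_def \<nu>_def add.assoc)
  show "(let r = half_shift n r; s = half_shift n s; u = r - of_int (n - 1) / 2; v =
    s + of_int (n + 1) / 2
        in q powi \<lfloor>of_int n * (u gchoose 2) + of_int (n + p) * u * v + of_int n * (v gchoose 2)\<rfloor>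
           * (- x) powi \<lfloor>u\<rfloor> * (- y) powi \<lfloor>v\<rfloor>
           * (J1 (p\<^sup>2 * (2 * n + p)) q ^ 3
              * jtheta (- (q powi \<lfloor>of_int (n * p) * (s - r)\<rfloor>) *
                (x powi n / y powi n)) (q powi (n * p\<^sup>2))
              * jtheta (q powi \<lfloor>of_int (p * (2 * n + p)) * (r + s) + of_int (p * (n + p))\<rfloor> *
                x powi p * y powi p)
                       (q powi (p\<^sup>2 * (2 * n + p))))
           / (theta_den n p x y q r * theta_den n p y x q s)) =
    ((- x) powi (r + \<nu> - n) * (- y) powi (s + \<nu>) *
      q powi (n * binom2 (r + \<nu> - n) + b * (r + \<nu> - n) * (s + \<nu>) + n * binom2 (s + \<nu>))) *
    (jtheta (- (q powi (n * p * (s - r))) * (x powi n / y powi n)) (q powi (n * p\<^sup>2)) *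
     (qpoch_inf Q Q ^ 3 * jtheta (A r * B s) Q / (jtheta (A r) Q * jtheta (B s) Q)))"
    unfolding Let_def u v f1 f2 f3 dA dB Q J AB floor_of_int Q_def[symmetric]
      by (simp add: field_simps)
qed

text \<open>The index k of the first numerator theta function and the indices i, j of Kronecker's
  series, together with the residues r, s modulo p, parametrise the full lattice.\<close>

lemma theta_np_triple_sum:
  fixes n p :: int
  assumes q: "0 < norm q" "norm q < 1" and np: "n > 0" "p > 0" and nz: "x \<noteq> 0" "y \<noteq> 0"
    and off: "\<And>m. norm (pole_arg n (n + p) x y q m) \<noteq> 1" "\<And>m. norm (pole_arg n (n + p) y x q m) \<noteq> 1"
    and den: "\<And>k. k \<in> {0..p-1} \<Longrightarrow> theta_den n p x y q (half_shift n k) \<noteq> 0 \<and>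
      theta_den n p y x q (half_shift n k) \<noteq> 0"
  shows "((\<lambda>(r, s, k). of_int (nsg (inverse (pole_arg n (n + p) y x q (- n * k - r))) +
      nsg (inverse (pole_arg n (n + p) x y q (n * (k - 1) - s)))) / 2 * hecke_term n (n +
        p) x y q (r, s, k)) has_sum
    theta_np n p x y q) UNIV"
proof -
  define b where "b = n + p"
  define \<nu> where "\<nu> = n div 2 + 1"
  define D where "D = b\<^sup>2 - n * n"
  define Q where "Q = q powi (p * D)"
  define A where "A r = inverse (pole_arg n b y x q (- (r + \<nu>)))" for r
  define B where "B s = inverse (pole_arg n b x y q (- (s + \<nu>)))" for s
  define \<theta> where "\<theta> r s = - (q powi (n * p * (s - r))) * (x powi n / y powi n)" for r s
  define c where "c r s = (- x) powi (r + \<nu> - n) * (- y) powi (s + \<nu>) *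
      q powi (n * binom2 (r + \<nu> - n) + b * (r + \<nu> - n) * (s + \<nu>) + n * binom2 (s + \<nu>))" for r s
  define e where "e = n * binom2 (b + 1) - n * binom2 (n + 1)"
  have D: "D = p * (2 * n + p)" by (simp add: D_def b_def power2_eq_square algebra_simps)
  have e2: "2 * e = n * (D + p)"
  proof -
    have "2 * e = n * (2 * binom2 (b + 1)) - n * (2 * binom2 (n + 1))"
      by (simp add: e_def algebra_simps)
    also have "\<dots> = n * (D + p)" unfolding two_binom2 D b_def by (simp add: algebra_simps)
    finally show ?thesis .
  qed
  have q0: "q \<noteq> 0" using q by auto
  have "D > 0" using np by (simp add: D)
  then have Q: "0 < norm Q" "norm Q < 1"
    using np norm_powi_less_1[OF q, of "p * D"] by (auto simp: Q_def)
  have Q2: "0 < norm (q powi (n * p\<^sup>2))" "norm (q powi (n * p\<^sup>2)) < 1"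
    using np norm_powi_less_1[OF q, of "n * p\<^sup>2"] by auto
  have QA: "Q powi m * A r = inverse (pole_arg n b y x q (- (r + \<nu>) - p * m))" for m r
    unfolding A_def Q_def power_int_mult[symmetric]
      using pole_arg_shift[OF q0, of "p * m" b n y x "- (r + \<nu>)"]
    by (simp add: D_def mult_ac)
  have QB: "Q powi m * B s = inverse (pole_arg n b x y q (- (s + \<nu>) - p * m))" for m s
    unfolding B_def Q_def power_int_mult[symmetric]
      using pole_arg_shift[OF q0, of "p * m" b n x y "- (s + \<nu>)"]
    by (simp add: D_def mult_ac)
  have pa0: "pole_arg n b x y q m \<noteq> 0" "pole_arg n b y x q m \<noteq> 0" for m
    using q0 nz by (simp_all add: pole_arg_def)
  have A0: "A r \<noteq> 0" and B0: "B s \<noteq> 0" for r s using pa0 by (auto simp: A_def B_def)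
  have offA: "norm (Q powi m * A r) \<noteq> 1" for m r
    unfolding QA norm_inverse using off(2)[of "- (r + \<nu>) - p * m"] by (simp add: b_def)
  have offB: "norm (Q powi m * B s) \<noteq> 1" for m s
    unfolding QB norm_inverse using off(1)[of "- (s + \<nu>) - p * m"] by (simp add: b_def)
  define K where "K r s = (\<lambda>(i, j). of_int (nsg (Q powi j * A r) + nsg (Q powi i * B s)) / 2 *
    Q powi (i * j) * A r powi i * B s powi j)" for r s
  define th where "th r s k = (-1) powi k * (q powi (n * p\<^sup>2)) powi binom2 k *
    \<theta> r s powi k" for r s k
  have dA: "jtheta (A r) Q \<noteq> 0" if "r \<in> {0..p-1}" for r
    using den[OF that] by (simp add: theta_den_eq A_def Q_def D_def b_def \<nu>_def add.assoc)
  have dB: "jtheta (B s) Q \<noteq> 0" if "s \<in> {0..p-1}" for s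
    using den[OF that] by (simp add: theta_den_eq B_def Q_def D_def b_def \<nu>_def add.assoc)
  have summand: "((\<lambda>v. case u of (r, s) \<Rightarrow> c r s * (case v of (k, w) \<Rightarrow> th r s k * K r s w)) has_sum
      (case u of (r, s) \<Rightarrow> c r s * (jtheta (\<theta> r s) (q powi (n * p\<^sup>2)) *
        (qpoch_inf Q Q ^ 3 * jtheta (A r * B s) Q / (jtheta (A r) Q *
          jtheta (B s) Q))))) (UNIV \<times> UNIV)"
    if "u \<in> {0..p-1} \<times> {0..p-1}" for u
  proof -
    obtain r s where u: "u = (r, s)" by (cases u)
    obtain G where G: "(K r s has_sum G) UNIV" "jtheta (A r) Q * jtheta (B s) Q * G =
      qpoch_inf Q Q ^ 3 * jtheta (A r * B s) Q"
      unfolding K_def by (rule kronecker_theta[OF Q A0[of r] B0[of s] offA offB])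
    have "qpoch_inf Q Q ^ 3 * jtheta (A r * B s) Q / (jtheta (A r) Q * jtheta (B s) Q) = G"
      using dA[of r] dB[of s] that unfolding G(2)[symmetric] by (simp add: u)
    moreover have "(th r s has_sum jtheta (\<theta> r s) (q powi (n * p\<^sup>2))) UNIV"
      unfolding th_def by (rule jacobi_triple_product[OF Q2]) (use q0 nz in \<open>simp add: \<theta>_def\<close>)
    ultimately show ?thesis unfolding u split
      by (simp only:) (intro has_sum_cmult_right has_sum_times_complex G)
  qed
  have "((\<lambda>(u, v). case u of (r, s) \<Rightarrow> c r s * (case v of (k, w) \<Rightarrow> th r s k * K r s w)) has_sum
      (\<Sum>u\<in>{0..p-1} \<times> {0..p-1}. case u of (r, s) \<Rightarrow> c r s * (jtheta (\<theta> r s) (q powi (n * p\<^sup>2)) *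
        (qpoch_inf Q Q ^ 3 * jtheta (A r * B s) Q / (jtheta (A r) Q *
          jtheta (B s) Q))))) (({0..p-1} \<times> {0..p-1}) \<times> (UNIV \<times> UNIV))"
    by (intro has_sum_finite_Sigma summand) auto
  also have "(\<Sum>u\<in>{0..p-1} \<times> {0..p-1}. case u of (r, s) \<Rightarrow> c r s * (jtheta (\<theta> r s) (q powi (n *
    p\<^sup>2)) *
        (qpoch_inf Q Q ^ 3 * jtheta (A r * B s) Q / (jtheta (A r) Q * jtheta (B s) Q)))) =
          theta_np n p x y q"
    unfolding theta_np_eq[OF q np nz] c_def \<theta>_def Q_def D_def A_def B_def b_def \<nu>_def ..
  also have "((\<lambda>(u, v). case u of (r, s) \<Rightarrow> c r s * (case v of (k, w) \<Rightarrow> th r s k *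
    K r s w)) has_sum theta_np n p x y q)
      (({0..p-1} \<times> {0..p-1}) \<times> (UNIV \<times> UNIV)) \<longleftrightarrow>
    ((\<lambda>(r, s, k). of_int (nsg (inverse (pole_arg n b y x q (- n * k - r))) +
      nsg (inverse (pole_arg n b x y q (n * (k - 1) - s)))) / 2 *
      hecke_term n b x y q (r, s, k)) has_sum theta_np n p x y q) UNIV"
  \<comment> \<open>The first two new coordinates R, S collect the exponents of -x and -y; the third
    is \<kappa> = 1 - k + i - j. As b - n = p, removing n (1 - \<kappa>) from R and adding it to S
    leaves r + p j and s + p i up to constants. Division by p therefore recovers r, j and s, i, and
    then \<kappa> determines k.\<close>
  proof (rule has_sum_reindex_bij_witness[of _
        "\<lambda>(r, s, k). let U = r - n * (1 - k) - \<nu> + n; V = s + n * (1 - k) - \<nu>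
           in ((U mod p, V mod p), (1 - k + V div p - U div p, (V div p, U div p)))"
        "\<lambda>((r, s), (k, (i, j))). (r + \<nu> - n + n * k - n * i + b * j, s + \<nu> - n * k + b * i - n *
          j, 1 - k + i - j)"])
    fix v :: "(int \<times> int) \<times> (int \<times> (int \<times> int))"
    assume v: "v \<in> ({0..p-1} \<times> {0..p-1}) \<times> (UNIV \<times> UNIV)"
    obtain r s k i j where v_eq: "v = ((r, s), (k, (i, j)))" by (metis surj_pair)
    have rs: "0 \<le> r" "r < p" "0 \<le> s" "s < p" using v by (auto simp: v_eq)
    define R where "R = r + \<nu> - n + n * k - n * i + b * j"
    define S where "S = s + \<nu> - n * k + b * i - n * j"
    define \<kappa> where "\<kappa> = 1 - k + i - j"
    have U: "R - n * (1 - \<kappa>) - \<nu> + n = r + p * j" by (simp add: R_def \<kappa>_def b_def algebra_simps)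
    have V: "S + n * (1 - \<kappa>) - \<nu> = s + p * i" by (simp add: S_def \<kappa>_def b_def algebra_simps)
    show "(\<lambda>(r, s, k). let U = r - n * (1 - k) - \<nu> + n; V = s + n * (1 - k) - \<nu>
           in ((U mod p, V mod p), (1 - k + V div p - U div p, (V div p, U div p))))
        ((\<lambda>((r, s), (k, (i, j))). (r + \<nu> - n + n * k - n * i + b * j, s + \<nu> - n * k + b * i - n *
          j, 1 - k + i - j)) v) = v"
      unfolding v_eq split R_def[symmetric] S_def[symmetric] \<kappa>_def[symmetric] Let_def U V
      using rs by (simp add: div_pos_pos_trivial mod_pos_pos_trivial \<kappa>_def)
    \<comment> \<open>These are the indices at which the second and the first half of g have their
      poles, so the same signs appear there.\<close>
    have a1: "- n * \<kappa> - R = - (r + \<nu>) - p * j" by (simp add: R_def \<kappa>_def b_def algebra_simps)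
    have a2: "n * (\<kappa> - 1) - S = - (s + \<nu>) - p * i" by (simp add: S_def \<kappa>_def b_def algebra_simps)
    have h1: "th r s k = (- x) powi (n * k) * (- y) powi (- (n * k)) * q powi (n * p\<^sup>2 *
      binom2 k + n * p * (s - r) * k)"
    proof -
      have "x powi n / y powi n = (- x) powi n / (- y) powi n" by (simp add: power_int_minus_left)
      then have "(-1) powi k * \<theta> r s powi k =
        (q powi (n * p * (s - r)) * ((- x) powi n / (- y) powi n)) powi k"
        by (simp add: \<theta>_def flip: power_int_mult_distrib)
      then have "th r s k = (q powi (n * p\<^sup>2)) powi binom2 k * (q powi (n * p * (s - r)) *
        ((- x) powi n / (- y) powi n)) powi k"
        by (simp add: th_def mult_ac)
      also have "\<dots> = (- x) powi (n * k) * (- y) powi (- (n * k)) * (q powi (n * p\<^sup>2 * binom2 k) *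
        q powi (n * p * (s - r) * k))"
        by (simp only: power_int_mult_distrib power_int_divide_distrib power_int_mult[symmetric]
          power_int_minus power_int_inverse divide_inverse mult_ac)
      finally show ?thesis using q0 by (simp add: power_int_add)
    qed
    have h2: "A r powi i = q powi ((D * (r + \<nu>) - e) * i) * (- y) powi (b * i) *
      (- x) powi (- (n * i))"
    proof -
      have "A r = q powi (- (e + (- (r + \<nu>)) * D)) * ((- y) powi b * inverse ((- x) powi n))"
        unfolding A_def pole_arg_def D_def[symmetric] e_def[symmetric] power_int_minus
          by (simp add: field_simps)
      also have "- (e + (- (r + \<nu>)) * D) = D * (r + \<nu>) - e" by (simp add: algebra_simps)
      finally show ?thesis
        by (simp only: power_int_mult_distrib power_int_mult[symmetric] power_int_minus
          power_int_inverse mult_ac)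
    qed
    have h3: "B s powi j = q powi ((D * (s + \<nu>) - e) * j) * (- x) powi (b * j) *
      (- y) powi (- (n * j))"
    proof -
      have "B s = q powi (- (e + (- (s + \<nu>)) * D)) * ((- x) powi b * inverse ((- y) powi n))"
        unfolding B_def pole_arg_def D_def[symmetric] e_def[symmetric] power_int_minus
          by (simp add: field_simps)
      also have "- (e + (- (s + \<nu>)) * D) = D * (s + \<nu>) - e" by (simp add: algebra_simps)
      finally show ?thesis
        by (simp only: power_int_mult_distrib power_int_mult[symmetric] power_int_minus
          power_int_inverse mult_ac)
    qed
    have h4: "Q powi (i * j) = q powi (p * D * (i * j))" by (simp add: Q_def power_int_mult)
    have ee: "(n * binom2 (r + \<nu> - n) + b * (r + \<nu> - n) * (s + \<nu>) + n * binom2 (s + \<nu>)) +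
        ((n * p\<^sup>2 * binom2 k + n * p * (s - r) * k) + (p * D * (i * j) + ((D * (r + \<nu>) - e) * i +
          (D * (s + \<nu>) - e) * j))) =
        n * binom2 R + b * R * S + n * binom2 S + n * D * binom2 \<kappa>"
    proof -
      \<comment> \<open>In the variables u and w the constant \<nu> drops out; after doubling, a
        polynomial identity remains.\<close>
      define u where "u = r + \<nu> - n"
      define w where "w = s + \<nu>"
      have sub: "r + \<nu> = u + n" "s - r = w - u - n" "s + \<nu> = w" "r + \<nu> - n = u"
        by (auto simp: u_def w_def)
      have "2 * ((n * binom2 u + b * u * w + n * binom2 w) +
        ((n * p\<^sup>2 * binom2 k + n * p * (w - u - n) * k) + (p * D * (i * j) + ((D * (u + n) - e) *
          i + (D * w - e) * j)))) =
        n * (2 * binom2 u) + 2 * (b * u * w) + n * (2 * binom2 w) + n * p\<^sup>2 * (2 * binom2 k) + 2 *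
          (n * p * (w - u - n) * k) +
        2 * (p * D * (i * j)) + (2 * (D * (u + n)) - 2 * e) * i + (2 * (D * w) - 2 * e) * j"
        by (simp add: algebra_simps)
      also have "\<dots> = n * (2 * binom2 (u + n * k - n * i + b * j)) + 2 * (b * (u + n * k - n * i +
        b * j) * (w - n * k + b * i - n * j)) +
          n * (2 * binom2 (w - n * k + b * i - n * j)) + n * D * (2 * binom2 (1 - k + i - j))"
        unfolding two_binom2 e2 D b_def power2_eq_square by algebra
      finally show ?thesis unfolding R_def S_def \<kappa>_def sub by simp
    qed
    have hR: "(- x) powi R = (- x) powi (r + \<nu> - n) * (- x) powi (n * k) * (- x) powi (- (n *
      i)) * (- x) powi (b * j)"
      using nz by (simp add: R_def flip: power_int_add)
    have hS: "(- y) powi S = (- y) powi (s + \<nu>) * (- y) powi (- (n * k)) * (- y) powi (b * i) *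
      (- y) powi (- (n * j))"
      using nz by (simp add: S_def flip: power_int_add)
    have qsum: "q powi (E1 + (E2 + (E3 + (E4 + E5)))) =
      q powi E1 * (q powi E2 * (q powi E3 * (q powi E4 * q powi E5)))" for E1 E2 E3 E4 E5
      using q0 by (simp add: power_int_add)
    have hW: "c r s * (th r s k * (W * Q powi (i * j) * A r powi i * B s powi j)) =
        W * ((- x) powi R * (- y) powi S * q powi (n * binom2 R + b * R * S + n * binom2 S + n *
          D * binom2 \<kappa>))" for W
      unfolding h1 h2 h3 h4 c_def ee[symmetric] hR hS qsum by (simp only: mult_ac)
    show "(\<lambda>(r, s, k). of_int (nsg (inverse (pole_arg n b y x q (- n * k - r))) +
      nsg (inverse (pole_arg n b x y q (n * (k - 1) - s)))) / 2 *
        hecke_term n b x y q (r, s, k))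
        ((\<lambda>((r, s), (k, (i, j))). (r + \<nu> - n + n * k - n * i + b * j, s + \<nu> - n * k + b * i - n *
          j, 1 - k + i - j)) v) =
      (case v of (u, v) \<Rightarrow> case u of (r, s) \<Rightarrow> c r s * (case v of (k, w) \<Rightarrow> th r s k * K r s w))"
      unfolding v_eq split R_def[symmetric] S_def[symmetric] \<kappa>_def[symmetric] a1 a2 hecke_term_def
        K_def QA QB D_def[symmetric]
      by (simp only: hW)
  next
    fix v :: "int \<times> int \<times> int"
    obtain r s k where v_eq: "v = (r, s, k)" by (metis surj_pair)
    define U where "U = r - n * (1 - k) - \<nu> + n"
    define V where "V = s + n * (1 - k) - \<nu>"
    have U: "U mod p + p * (U div p) = U" and V: "V mod p + p * (V div p) = V" by simp_all
    have "U mod p + \<nu> - n + n * (1 - k + V div p - U div p) - n * (V div p) + b * (U div p) = r"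
      using U unfolding b_def by (simp add: U_def[symmetric] algebra_simps) (simp add: U_def
        algebra_simps)
    moreover have "V mod p + \<nu> - n * (1 - k + V div p - U div p) + b * (V div p) - n * (U div p) =
      s"
      using V unfolding b_def by (simp add: V_def[symmetric] algebra_simps) (simp add: V_def
        algebra_simps)
    ultimately show "(\<lambda>((r, s), (k, (i, j))). (r + \<nu> - n + n * k - n * i + b * j, s + \<nu> - n * k +
      b * i - n * j, 1 - k + i - j))
        ((\<lambda>(r, s, k). let U = r - n * (1 - k) - \<nu> + n; V = s + n * (1 - k) - \<nu>
           in ((U mod p, V mod p), (1 - k + V div p - U div p, (V div p, U div p)))) v) = v"
      unfolding v_eq split Let_def U_def[symmetric] V_def[symmetric] by simp
    show "(\<lambda>(r, s, k). let U = r - n * (1 - k) - \<nu> + n; V = s + n * (1 - k) - \<nu>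
           in ((U mod p, V mod p), (1 - k + V div p - U div p, (V div p, U div p)))) v
        \<in> ({0..p-1} \<times> {0..p-1}) \<times> (UNIV \<times> UNIV)"
      using np pos_mod_bound[of p] by (simp add: v_eq Let_def)
  qed auto
  finally show ?thesis by (simp add: b_def)
qed

section \<open>Continuity and the main theorem\<close>

lemma hecke_g_eq_half_g: "hecke_g n b n x y q (-1) (-1) = half_g n b x y q + half_g n b y x q"
  by (simp add: hecke_g_def half_g_def)

lemma hecke_identity_off_circles:
  fixes n p :: int
  assumes q: "0 < norm q" "norm q < 1" and np: "n > 0" "p > 0" and nz: "x \<noteq> 0" "y \<noteq> 0"
    and off: "\<And>m. norm (pole_arg n (n + p) x y q m) \<noteq> 1" "\<And>m. norm (pole_arg n (n + p) y x q m) \<noteq> 1"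
    and den: "\<And>k. k \<in> {0..p-1} \<Longrightarrow> theta_den n p x y q (half_shift n k) \<noteq> 0 \<and>
      theta_den n p y x q (half_shift n k) \<noteq> 0"
  shows "hecke_f n (n + p) n x y q =
    hecke_g n (n + p) n x y q (-1) (-1) + 1 / Jbar 0 (n * p * (2 * n + p)) q * theta_np n p x y q"
proof -
  define b where "b = n + p"
  have b: "b > n" using np by (simp add: b_def)
  define Q where "Q = q powi (n * (b\<^sup>2 - n * n))"
  define Zx where "Zx = (\<lambda>(r::int, s, k). pole_arg n b x y q (n * (k - 1) - s))"
  define Zy where "Zy = (\<lambda>(r, s::int, k). pole_arg n b y x q (- n * k - r))"
  define T where "T = hecke_term n b x y q"
  have D: "n * (b\<^sup>2 - n * n) = n * p * (2 * n + p)"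
    by (simp add: b_def power2_eq_square algebra_simps)
  then have "n * (b\<^sup>2 - n * n) > 0" using np by (simp only: D) simp
  then have Q: "0 < norm Q" "norm Q < 1"
    unfolding Q_def by (rule norm_powi_less_1[OF q])+
  have f: "((\<lambda>v. case v of (r, s, k) \<Rightarrow> of_int (sg r + sg s) / 2 * T v) has_sum
    hecke_f n b n x y q * jtheta (-1) Q) UNIV"
    using hecke_f_triple_sum[OF q np(1) b nz] by (simp add: Q_def T_def case_prod_unfold)
  have g1: "((\<lambda>v. case v of (r, s, k) \<Rightarrow> of_int (sg s + nsg (Zx v)) / 2 * T v) has_sum
    half_g n b x y q * jtheta (-1) Q) UNIV"
    using half_g_triple_sum[OF q np(1) b nz] off(1)
      by (simp add: Q_def T_def Zx_def case_prod_unfold b_def)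
  have "((\<lambda>(r, s, k). of_int (sg s + nsg (pole_arg n b y x q (n * (k - 1) - s))) / 2 *
    hecke_term n b y x q (r, s, k)) has_sum
    half_g n b y x q * jtheta (-1) Q) UNIV"
    unfolding Q_def by (rule half_g_triple_sum[OF q np(1) b nz(2,1)]) (simp add: b_def off(2))
  \<comment> \<open>Exchanging r and s brings back the monomials in (x, y). The reflection k -> 1 -
    k preserves binom(k,2) and moves the pole index to - n k - r, the one occurring in the theta
    quotients.\<close>
  also have "?this \<longleftrightarrow> ((\<lambda>v. case v of (r, s, k) \<Rightarrow> of_int (sg r + nsg (Zy v)) / 2 * T v) has_sum
    half_g n b y x q * jtheta (-1) Q) UNIV"
    by (rule has_sum_reindex_bij_witness[of _ "\<lambda>(r, s, k). (s, r, 1 - k)" "\<lambda>(r, s, k). (s, r,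
      1 - k)"])
      (auto simp: Zy_def T_def hecke_term_def binom2_reflect algebra_simps)
  finally have g2: "((\<lambda>v. case v of (r, s, k) \<Rightarrow> of_int (sg r + nsg (Zy v)) / 2 * T v) has_sum
    half_g n b y x q * jtheta (-1) Q) UNIV" .
  have th: "((\<lambda>v. of_int (nsg (inverse (Zy v)) + nsg (inverse (Zx v))) / 2 * T v) has_sum
    theta_np n p x y q) UNIV"
    using theta_np_triple_sum[OF q np nz off den]
      by (simp add: T_def Zx_def Zy_def case_prod_unfold b_def)
  have inv: "nsg (inverse (Zx v)) = - nsg (Zx v)" "nsg (inverse (Zy v)) = - nsg (Zy v)" for v
  proof -
    have "pole_arg n b x y q m \<noteq> 0" "pole_arg n b y x q m \<noteq> 0" for m
      using q nz by (auto simp: pole_arg_def)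
    then show "nsg (inverse (Zx v)) = - nsg (Zx v)" "nsg (inverse (Zy v)) = - nsg (Zy v)"
      using off by (auto simp: Zx_def Zy_def case_prod_unfold b_def intro!: nsg_inverse)
  qed
  have "((\<lambda>v. (case v of (r, s, k) \<Rightarrow> of_int (sg s + nsg (Zx v)) / 2 * T v) +
      (case v of (r, s, k) \<Rightarrow> of_int (sg r + nsg (Zy v)) / 2 * T v) +
      of_int (nsg (inverse (Zy v)) + nsg (inverse (Zx v))) / 2 * T v) has_sum
      half_g n b x y q * jtheta (-1) Q + half_g n b y x q * jtheta (-1) Q +
        theta_np n p x y q) UNIV"
    by (intro has_sum_add g1 g2 th)
  also have "(\<lambda>v. (case v of (r, s, k) \<Rightarrow> of_int (sg s + nsg (Zx v)) / 2 * T v) +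
      (case v of (r, s, k) \<Rightarrow> of_int (sg r + nsg (Zy v)) / 2 * T v) +
      of_int (nsg (inverse (Zy v)) + nsg (inverse (Zx v))) / 2 * T v) =
      (\<lambda>v. case v of (r, s, k) \<Rightarrow> of_int (sg r + sg s) / 2 * T v)"
    unfolding inv by (auto simp: fun_eq_iff field_simps)
  finally have "hecke_f n b n x y q * jtheta (-1) Q =
      half_g n b x y q * jtheta (-1) Q + half_g n b y x q * jtheta (-1) Q + theta_np n p x y q"
    by (rule has_sum_unique[OF f])
  moreover have "Jbar 0 (n * p * (2 * n + p)) q = jtheta (-1) Q" by (simp add: Jbar_def Q_def D)
  ultimately show ?thesis
    using jtheta_minus_1(2)[OF Q] unfolding hecke_g_eq_half_g b_def[symmetric]
      by (simp add: field_simps)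
qed

section \<open>Continuity in x\<close>

lemma eventually_norm_between:
  fixes x :: complex
  assumes "x \<noteq> 0"
  shows "\<forall>\<^sub>F x' in at x. norm (x / 2) \<le> norm x' \<and> norm x' \<le> norm (2 * x)"
proof -
  have "((\<lambda>x'. norm x') \<longlongrightarrow> norm x) (at x)" by (intro tendsto_intros)
  then have "\<forall>\<^sub>F x' in at x. norm x' > norm x / 2" "\<forall>\<^sub>F x' in at x. norm x' < 2 * norm x"
    by (rule order_tendstoD, use assms in simp)+
  then show ?thesis by eventually_elim (auto simp: norm_divide norm_mult)
qed

text \<open>Near x every term is dominated by the sum of its norms at x/2 and 2x, by
  \<open>real_powi_between\<close>.\<close>

lemma isCont_jtheta:
  assumes q: "0 < norm q" "norm q < 1" and x: "x \<noteq> 0"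
  shows "isCont (\<lambda>x. jtheta x q) x"
proof -
  define F where "F x k = (-1) powi k * q powi binom2 k * x powi k" for x and k :: int
  have j: "jtheta x q = infsum (F x) UNIV" if "x \<noteq> 0" for x
    using jacobi_triple_product[OF q that] by (simp add: F_def[abs_def] has_sum_iff)
  have "((\<lambda>x'. infsum (F x') UNIV) \<longlongrightarrow> infsum (F x) UNIV) (at x)"
  proof (rule tendsto_infsum_dominated)
    show "(\<lambda>k. norm q powi binom2 k * norm (x / 2) powi k + norm q powi binom2 k * norm (2 *
      x) powi k) summable_on UNIV"
      using q x by (intro summable_on_add theta_series_summable_real) auto
    show "\<forall>\<^sub>F x' in at x. \<forall>k\<in>UNIV. norm (F x' k) \<le>
      norm q powi binom2 k * norm (x / 2) powi k + norm q powi binom2 k * norm (2 * x) powi k"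
      using eventually_norm_between[OF x]
    proof eventually_elim
      case (elim x')
      show ?case
      proof
        fix k :: int
        have "norm x' powi k \<le> norm (x / 2) powi k + norm (2 * x) powi k"
          using elim x by (intro real_powi_between) auto
        then have "norm q powi binom2 k * norm x' powi k \<le>
          norm q powi binom2 k * (norm (x / 2) powi k + norm (2 * x) powi k)"
          by (rule mult_left_mono) simp
        then show "norm (F x' k) \<le> norm q powi binom2 k * norm (x / 2) powi k +
          norm q powi binom2 k * norm (2 * x) powi k"
          unfolding F_def norm_mult norm_power_int by (simp add: distrib_left del: norm_divide)
      qed
    qed
    show "((\<lambda>x'. F x' k) \<longlongrightarrow> F x k) (at x)" for k
      unfolding F_def using x by (intro tendsto_intros) auto
  qed
  moreover have "\<forall>\<^sub>F x' in at x. infsum (F x') UNIV = jtheta x' q"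
    using tendsto_imp_eventually_ne[OF tendsto_ident_at x] by eventually_elim (simp add: j)
  ultimately show ?thesis
    unfolding isCont_def j[OF x] by (rule Lim_transform_eventually)
qed

lemma isCont_jtheta_comp:
  assumes "0 < norm q" "norm q < 1" "isCont f a" "f a \<noteq> 0"
  shows "isCont (\<lambda>x. jtheta (f x) q) a"
  using isCont_o2[OF assms(3) isCont_jtheta[OF assms(1,2,4)]] .

text \<open>For fixed (r, s) the norm of the summand is a constant times |x|^r, so the absolutely
  convergent series at x/2 and 2x together dominate those at nearby points.\<close>

lemma isCont_hecke_f:
  fixes q x y :: complex
  assumes q: "0 < norm q" "norm q < 1" and n: "n > 0" and b: "b > 0" and nz: "x \<noteq> 0" "y \<noteq> 0"
  shows "isCont (\<lambda>x. hecke_f n b n x y q) x"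
proof -
  define F where "F x = (\<lambda>(r, s). of_int (sg r + sg s) / 2 * ((- x) powi r * (- y) powi s *
     q powi (n * binom2 r + b * r * s + n * binom2 s)))" for x
  have h: "(F x has_sum hecke_f n b n x y q) UNIV" if "x \<noteq> 0" for x
    unfolding F_def by (rule hecke_f_has_sum[OF q n b that nz(2)])
  then have hi: "hecke_f n b n x y q = infsum (F x) UNIV" if "x \<noteq> 0" for x
    using that by (simp add: has_sum_iff)
  have ns: "(\<lambda>v. norm (F x v)) summable_on UNIV" if "x \<noteq> 0" for x
    using h[OF that] by (auto simp: has_sum_iff summable_on_iff_abs_summable_on_complex)
  have "((\<lambda>x'. infsum (F x') UNIV) \<longlongrightarrow> infsum (F x) UNIV) (at x)"
  proof (rule tendsto_infsum_dominated)
    show "(\<lambda>v. norm (F (x / 2) v) + norm (F (2 * x) v)) summable_on UNIV"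
      using nz by (intro summable_on_add ns) auto
    show "\<forall>\<^sub>F x' in at x. \<forall>v\<in>UNIV. norm (F x' v) \<le> norm (F (x / 2) v) + norm (F (2 * x) v)"
      using eventually_norm_between[OF nz(1)]
    proof eventually_elim
      case (elim x')
      show ?case
      proof
        fix v :: "int \<times> int"
        obtain r s where v: "v = (r, s)" by (cases v)
        define C where "C = norm (complex_of_int (sg r + sg s) / 2) * (norm (- y) powi s *
          norm q powi (n * binom2 r + b * r * s + n * binom2 s))"
        have F: "norm (F c v) = C * norm c powi r" for c
          unfolding F_def v split norm_mult norm_power_int C_def norm_minus_cancel
            by (simp only: mult_ac)
        have "norm x' powi r \<le> norm (x / 2) powi r + norm (2 * x) powi r"
          using elim nz by (intro real_powi_between) auto
        then have "C * norm x' powi r \<le> C * (norm (x / 2) powi r + norm (2 * x) powi r)"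
          by (rule mult_left_mono) (simp add: C_def)
        then show "norm (F x' v) \<le> norm (F (x / 2) v) + norm (F (2 * x) v)"
          unfolding F by (simp only: distrib_left)
      qed
    qed
    show "((\<lambda>x'. F x' v) \<longlongrightarrow> F x v) (at x)" for v
      unfolding F_def using nz by (cases v) (auto intro!: tendsto_intros)
  qed
  moreover have "\<forall>\<^sub>F x' in at x. infsum (F x') UNIV = hecke_f n b n x' y q"
    using tendsto_imp_eventually_ne[OF tendsto_ident_at nz(1)] by eventually_elim (simp add: hi)
  ultimately show ?thesis
    unfolding isCont_def hi[OF nz(1)] by (rule Lim_transform_eventually)
qed

text \<open>With c from \<open>pole_distance\<close> and |z' - z| < c/2, every denominator at z' has
  norm at least c/2. This bound, uniform in k, gives the constant 2/c in the majorant.\<close>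

lemma isCont_appell_lerch:
  fixes q z :: complex
  assumes q: "0 < norm q" "norm q < 1" and z: "z \<noteq> 0" "\<And>k::int. q powi k * z \<noteq> 1"
  shows "isCont (\<lambda>z. appell_lerch (- z) q (-1)) z"
proof -
  define F where "F z k = q powi binom2 k / (1 - q powi (k - 1) * z)" for z and k :: int
  obtain c where c: "c > 0" "\<And>k. norm (1 - q powi k * z) \<ge> c * (1 + norm q powi k)"
    using pole_distance[OF q z] by blast
  have a: "appell_lerch (- z) q (-1) = infsum (F z) UNIV / jtheta (-1) q" for z
    using appell_lerch_minus_1[OF q, of z] jtheta_minus_1(2)[OF q] unfolding F_def[abs_def]
      by (simp add: field_simps)
  have "((\<lambda>z'. infsum (F z') UNIV) \<longlongrightarrow> infsum (F z) UNIV) (at z)"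
  proof (rule tendsto_infsum_dominated)
    show "(\<lambda>k. norm q powi binom2 k * 1 powi k * (2 / c)) summable_on UNIV"
      using q by (intro summable_on_cmult_left theta_series_summable_real) auto
    have "\<forall>\<^sub>F z' in at z. dist z' z < c / 2"
      using c(1) by (intro tendstoD tendsto_ident_at) simp
    then show "\<forall>\<^sub>F z' in at z. \<forall>k\<in>UNIV. norm (F z' k) \<le> norm q powi binom2 k * 1 powi k * (2 / c)"
    proof eventually_elim
      case (elim z')
      show ?case
      proof
        fix k :: int
        have "norm (1 - q powi (k - 1) * z') \<ge> norm (1 - q powi (k - 1) *
          z) - norm (q powi (k - 1) * (z' - z))"
          using norm_triangle_ineq2[of "1 - q powi (k - 1) * z" "q powi (k - 1) * (z' - z)"]
            by (simp add: algebra_simps)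
        moreover have "norm (q powi (k - 1) * (z' - z)) \<le> norm q powi (k - 1) * (c / 2)"
          unfolding norm_mult norm_power_int using elim
            by (intro mult_left_mono) (auto simp: dist_norm)
        moreover have "norm q powi (k - 1) * (c / 2) \<ge> 0" using c by simp
        moreover have "c * (1 + norm q powi (k - 1)) = c + 2 * (norm q powi (k - 1) * (c / 2))"
          by (simp add: algebra_simps)
        ultimately have "norm (1 - q powi (k - 1) * z') \<ge> c / 2"
          using c(2)[of "k - 1"] c(1) by linarith
        then have "1 / norm (1 - q powi (k - 1) * z') \<le> 2 / c"
          using c(1) by (metis frac_le[of 1 1] divide_divide_eq_right half_gt_zero_iff mult_1
            order_refl zero_le_one)
        then have "norm q powi binom2 k * (1 / norm (1 - q powi (k - 1) * z')) \<le>
          norm q powi binom2 k * (2 / c)"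
          by (rule mult_left_mono) simp
        then show "norm (F z' k) \<le> norm q powi binom2 k * 1 powi k * (2 / c)"
          by (simp add: F_def norm_divide norm_power_int)
      qed
    qed
    show "((\<lambda>z'. F z' k) \<longlongrightarrow> F z k) (at z)" for k
      unfolding F_def using z(2)[of "k - 1"] by (intro tendsto_intros) auto
  qed
  then have "((\<lambda>z'. infsum (F z') UNIV / jtheta (-1) q) \<longlongrightarrow> infsum (F z) UNIV / jtheta (-1) q) (at z)"
    using jtheta_minus_1(2)[OF q] by (intro tendsto_intros)
  then show ?thesis unfolding isCont_def a .
qed

text \<open>Both arguments are functions of the point, since the varying x stands first in one half
  of g and second in the other.\<close>

lemma isCont_half_g:
  fixes q a :: complex
  assumes q: "0 < norm q" "norm q < 1" and n: "n > 0" and b: "b > n"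
    and cont: "isCont f a" "isCont g a" and nz: "f a \<noteq> 0" "g a \<noteq> 0"
    and def: "\<And>t. t \<in> {0..n-1} \<Longrightarrow> appell_lerch_defined (g_arg n b n (f a) (g a) q t) (q powi (n *
      (b\<^sup>2 - n * n))) (-1)"
  shows "isCont (\<lambda>z. half_g n b (f z) (g z) q) a"
proof -
  define Q where "Q = q powi (n * (b\<^sup>2 - n * n))"
  have q0: "q \<noteq> 0" using q by auto
  have "b\<^sup>2 - n * n > 0" using n b by (simp add: power2_eq_square mult_strict_mono)
  then have Q: "0 < norm Q" "norm Q < 1"
    using n norm_powi_less_1[OF q, of "n * (b\<^sup>2 - n * n)"] by (auto simp: Q_def)
  have Q0: "Q \<noteq> 0" using Q by auto
  have al: "isCont (\<lambda>z. appell_lerch (g_arg n b n (f z) (g z) q t) Q (-1))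
    a" if t: "t \<in> {0..n-1}" for t
  proof -
    have "isCont (\<lambda>z. - g_arg n b n (f z) (g z) q t) a"
      unfolding g_arg_def using nz by (intro continuous_intros cont) auto
    moreover have "isCont (\<lambda>z. appell_lerch (- z) Q (-1)) (- g_arg n b n (f a) (g a) q t)"
    proof (rule isCont_appell_lerch[OF Q])
      show "- g_arg n b n (f a) (g a) q t \<noteq> 0"
        using def[OF t] by (auto simp: appell_lerch_defined_def)
      fix k :: int
      show "Q powi k * - g_arg n b n (f a) (g a) q t \<noteq> 1"
      proof
        assume "Q powi k * - g_arg n b n (f a) (g a) q t = 1"
        then have "g_arg n b n (f a) (g a) q t * (-1) = Q powi (- k)"
          using Q0 by (simp add: power_int_minus field_simps)
        then show False using def[OF t] by (auto simp: appell_lerch_defined_def Q_def)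
      qed
    qed
    ultimately have "isCont (\<lambda>z. appell_lerch (- (- g_arg n b n (f z) (g z) q t)) Q (-1)) a"
      by (rule isCont_o2)
    then show ?thesis by simp
  qed
  show ?thesis
    unfolding half_g_def Q_def[symmetric] using nz q0
    by (intro continuous_intros cont al isCont_jtheta_comp norm_powi_less_1 q n) auto
qed

lemma isCont_theta_den:
  fixes q a :: complex
  assumes q: "0 < norm q" "norm q < 1" and np: "n > 0" "p > 0"
    and cont: "isCont f a" "isCont g a" and nz: "f a \<noteq> 0" "g a \<noteq> 0"
  shows "isCont (\<lambda>z. theta_den n p (f z) (g z) q r) a"
proof -
  have "q \<noteq> 0" using q by auto
  then show ?thesis
    unfolding theta_den_def using nz np
    by (intro continuous_intros cont isCont_jtheta_comp norm_powi_less_1 q) auto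
qed

lemma isCont_theta_np:
  fixes q x y :: complex
  assumes q: "0 < norm q" "norm q < 1" and np: "n > 0" "p > 0" and nz: "x \<noteq> 0" "y \<noteq> 0"
    and den: "\<And>k. k \<in> {0..p-1} \<Longrightarrow> theta_den n p x y q (half_shift n k) \<noteq> 0 \<and>
      theta_den n p y x q (half_shift n k) \<noteq> 0"
  shows "isCont (\<lambda>x. theta_np n p x y q) x"
proof -
  have "q \<noteq> 0" using q by auto
  then show ?thesis
    unfolding theta_np_def Let_def using nz np den
    by (intro continuous_intros isCont_theta_den isCont_jtheta_comp norm_powi_less_1 q) auto
qed

theorem theorem0p3:
  fixes q x y :: complex and n p :: int
  assumes "0 < norm q" and "norm q < 1"
    and "n > 0" and "p > 0" and "gcd n p = 1"
    and "x \<noteq> 0" and "y \<noteq> 0"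
    and "generic_xy n p x y q"
  shows "hecke_f n (n + p) n x y q =
    hecke_g n (n + p) n x y q (-1) (-1) + 1 / Jbar 0 (n * p * (2 * n + p)) q * theta_np n p x y q"
proof (rule ccontr)
  note q = assms(1,2) and np = assms(3,4) and nz = assms(6,7)
  \<comment> \<open>Genericity makes \<Delta> continuous at x. If it were nonzero there, it would be
    nonzero throughout a punctured neighbourhood, which must contain points covered by
    \<open>hecke_identity_off_circles\<close>.\<close>
  define \<Delta> where "\<Delta> x = hecke_f n (n + p) n x y q - (hecke_g n (n + p) n x y q (-1) (-1) +
      1 / Jbar 0 (n * p * (2 * n + p)) q * theta_np n p x y q)" for x
  define good where "good x \<longleftrightarrow> (\<forall>k\<in>{0..p-1}. theta_den n p x y q (half_shift n k) \<noteq> 0 \<and>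
    theta_den n p y x q (half_shift n k) \<noteq> 0)" for x
  have den: "theta_den n p x y q (half_shift n k) \<noteq> 0 \<and> theta_den n p y x q (half_shift n k) \<noteq>
    0" if "k \<in> {0..p-1}" for k
    using assms(8) that by (auto simp: generic_xy_def)
  have "isCont \<Delta> x"
    unfolding \<Delta>_def hecke_g_eq_half_g using assms(8) nz np
    by (intro continuous_intros isCont_hecke_f isCont_half_g isCont_theta_np den q) (auto simp:
      generic_xy_def)
  moreover assume "\<not> ?thesis"
  then have "\<Delta> x \<noteq> 0" by (simp add: \<Delta>_def)
  ultimately have "\<forall>\<^sub>F x' in at x. \<Delta> x' \<noteq> 0"
    unfolding isCont_def by (rule tendsto_imp_eventually_ne)
  moreover have "\<forall>\<^sub>F x' in at x. good x'"
    unfolding good_def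
  proof (intro eventually_ball_finite ballI eventually_conj)
    fix k assume k: "k \<in> {0..p-1}"
    have "isCont (\<lambda>x. theta_den n p x y q (half_shift n k)) x" "isCont (\<lambda>x.
      theta_den n p y x q (half_shift n k)) x"
      using nz by (intro isCont_theta_den q np continuous_intros; simp)+
    then show "\<forall>\<^sub>F x' in at x. theta_den n p x' y q (half_shift n k) \<noteq> 0" "\<forall>\<^sub>F x' in at x.
      theta_den n p y x' q (half_shift n k) \<noteq> 0"
      using den[OF k] by (auto simp: isCont_def intro: tendsto_imp_eventually_ne)
  qed auto
  ultimately have "\<forall>\<^sub>F x' in at x. \<Delta> x' \<noteq> 0 \<and> good x'" by (rule eventually_conj)
  then obtain d where d: "d > 0" "\<And>x'. x' \<noteq> x \<Longrightarrow> dist x' x < d \<Longrightarrow> \<Delta> x' \<noteq> 0 \<and> good x'"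
    by (auto simp: eventually_at)
  \<comment> \<open>The scaling factors s > 0 for which s x lies on an excluded circle: replacing x
    by s x multiplies the two families of pole norms by s^(-(n+p)) and s^n, so each m in each family
    excludes one s.\<close>
  define C where "C = range (\<lambda>m. root (nat (n + p)) (norm (pole_arg n (n + p) x y q m))) \<union>
      range (\<lambda>m. root (nat n) (1 / norm (pole_arg n (n + p) y x q m)))"
  have "countable C" unfolding C_def by (intro countable_Un countable_image) auto
  moreover have "uncountable {1<..<1 + d / norm x}" using d(1) nz
    by (simp add: uncountable_open_interval)
  ultimately have "{1<..<1 + d / norm x} - C \<noteq> {}"
    by (metis countable_empty uncountable_minus_countable)
  \<comment> \<open>The upper limit 1 + d/|x| keeps s x within distance d of x, and s > 1 keeps it
    different from x.\<close>
  then obtain s where "s \<in> {1<..<1 + d / norm x} - C" by (metis ex_in_conv)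
  then have s: "s > 1" "s < 1 + d / norm x" "s \<notin> C" by auto
  define x' where "x' = of_real s * x"
  have x': "x' \<noteq> 0" "x' \<noteq> x" using s(1) nz by (auto simp: x'_def)
  have "dist x' x = (s - 1) * norm x"
  proof -
    have "x' - x = of_real (s - 1) * x" by (simp add: x'_def algebra_simps)
    then show ?thesis using s(1) by (simp only: dist_norm norm_mult norm_of_real)
  qed
  also have "\<dots> < d" using s(2) nz by (simp add: field_simps)
  finally have good: "\<Delta> x' \<noteq> 0" "good x'" using d(2) x' by auto
  have off1: "norm (pole_arg n (n + p) x' y q m) \<noteq> 1" for m
  proof
    assume 1: "norm (pole_arg n (n + p) x' y q m) = 1"
    have "(- x') powi (n + p) = of_real s powi (n + p) * (- x) powi (n + p)"
      using power_int_mult_distrib[of "of_real s" "- x" "n + p"] by (simp add: x'_def)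
    then have "pole_arg n (n + p) x y q m = of_real s powi (n + p) * pole_arg n (n + p) x' y q m"
      using s(1) by (simp add: pole_arg_def field_simps)
    then have "norm (pole_arg n (n + p) x y q m) = s powi (n + p)"
      using 1 s(1) by (simp add: norm_mult norm_power_int)
    also have "\<dots> = s ^ nat (n + p)" using np by (simp add: power_int_def)
    finally have "root (nat (n + p)) (norm (pole_arg n (n + p) x y q m)) = s"
      using np s(1) by (simp add: real_root_power_cancel)
    then show False using s(3) by (auto simp: C_def)
  qed
  have off2: "norm (pole_arg n (n + p) y x' q m) \<noteq> 1" for m
  proof
    assume 1: "norm (pole_arg n (n + p) y x' q m) = 1"
    have "(- x') powi n = of_real s powi n * (- x) powi n"
      using power_int_mult_distrib[of "of_real s" "- x" n] by (simp add: x'_def)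
    then have "pole_arg n (n + p) y x' q m = of_real s powi n * pole_arg n (n + p) y x q m"
      by (simp add: pole_arg_def field_simps)
    then have "s powi n * norm (pole_arg n (n + p) y x q m) = 1"
      using 1 s(1) by (simp add: norm_mult norm_power_int)
    then have "1 / norm (pole_arg n (n + p) y x q m) = s powi n"
      by (metis div_by_1 mult_zero_right nonzero_eq_divide_eq one_neq_zero)
    also have "\<dots> = s ^ nat n" using np by (simp add: power_int_def)
    finally have "root (nat n) (1 / norm (pole_arg n (n + p) y x q m)) = s"
      using np s(1) by (simp add: real_root_power_cancel)
    then show False using s(3) by (auto simp: C_def)
  qed
  have "\<Delta> x' = 0"
    unfolding \<Delta>_def using hecke_identity_off_circles[OF q np x'(1) nz(2) off1 off2] good(2)
      by (simp add: good_def)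
  then show False using good(1) by simp
qed

end
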